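(* Let $A$ be a unital associative algebra over a field $\Bbbk$ of characteristic $0$. The homology of the complex $$\big(\overline\Omega\,\hat\otimes\,\Bbbk[t,t^{-1}],\ \mathsf d+t\cdot\imath_\Delta\big)$$ is isomorphic to $HP_{-\bullet}(A)$, the reduced periodic cyclic homology of $A$ (with inverted degrees).
   Context: $\otimes=\otimes_\Bbbk$. $\Omega^1A$ is the kernel of the multiplication map $A\otimes A\to A$, with $\mathsf d a=1\otimes a-a\otimes1$; $\Omega^\bullet A=T_A(\Omega^1A)$ is the DG algebra of noncommutative differential forms with differential $\mathsf d$; $\Omega^nA\cong A\otimes(A/\Bbbk)^{\otimes n}$, with elements written $a_0\,\mathsf d a_1\cdots\mathsf d a_n$. Reduced forms: $\overline\Omega^0=A/\Bbbk$, $\overline\Omega^k=\Omega^kA$ for $k>0$, $\overline\Omega=\bigoplus_{k\ge0}\overline\Omega^k$. For a graded vector space $M=\bigoplus_{i\ge0}M^i$, put $M\,\hat\otimes\,\Bbbk[t,t^{-1}]:=\bigoplus_{n\in\mathbb Z}\Big(\prod_{i\in\mathbb Z}t^iM^{n-2i}\Big)$, a $\mathbb Z$-graded $\Bbbk[t,t^{-1}]$-module with $|t|=2$. Homogeneous operators on $\overline\Omega$ are extended $\Bbbk[t,t^{-1}]$-linearly. The map $\imath_\Delta$ on $\Omega^\bullet A$, of degree $-1$, is zero on $\Omega^0A$ and for $n\ge1$ is given by $$\imath_\Delta(a_0\,\mathsf d a_1\cdots\mathsf d a_n)=\sum_{k=1}^n(-1)^{(k-1)(n-1)}[a_k,\ \mathsf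 d a_{k+1}\cdots\mathsf d a_n\,a_0\,\mathsf d a_1\cdots\mathsf d a_{k-1}];$$ it descends to $\overline\Omega$. One has $\mathsf d^2=\imath_\Delta^2=0$ and $\mathsf d\,\imath_\Delta+\imath_\Delta\,\mathsf d=0$, so $\mathsf d+t\cdot\imath_\Delta$ is a differential of degree $+1$. The Hochschild differential is $\mathsf b(\alpha\,\mathsf d a)=(-1)^{\deg\alpha}[\alpha,a]$, with $\mathsf b=0$ on $\Omega^0A$. The Connes differential is $\mathsf B(a_0\,\mathsf d a_1\cdots\mathsf d a_n)=\sum_{i=0}^n(-1)^{ni}\,\mathsf d a_i\cdots\mathsf d a_n\,\mathsf d a_0\cdots\mathsf d a_{i-1}$. The reduced periodic cyclic homology with inverted degrees is $HP_{-n}(A)=H^n\big(\overline\Omega\,\hat\otimes\,\Bbbk[t,t^{-1}],\ \mathsf B+t\cdot\mathsf b\big)$. *)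

theory Defs
  imports Complex_Main "HOL-Library.Poly_Mapping" "HOL-Library.Function_Algebras"
begin

section \<open>Quotients and free vector spaces\<close>

text \<open>
  For a subspace \<open>W\<close> of a vector space \<open>V\<close>, the map \<open>quot sc W\<close> is a linear projection of \<open>V\<close> with
  kernel \<open>W\<close>, i.e. a choice of normal form modulo \<open>W\<close>.  The quotient \<open>U / W\<close> of a subspace \<open>U\<close>
  containing \<open>W\<close> is \<open>quot sc W ` U\<close>, and \<open>quot sc W x\<close> is the class of \<open>x\<close> (see \<open>quot_eq_iff\<close>).
  With this model all quotients live in types of class \<open>ab_group_add\<close>, and a class is its own
  representative.
\<close>

definition quot :: "('k::field \<Rightarrow> 'v::ab_group_add \<Rightarrow> 'v) \<Rightarrow> 'v set \<Rightarrow> 'v \<Rightarrow> 'v" where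
  "quot sc W = (SOME p. Vector_Spaces.linear sc sc p \<and> (\<forall>v. p v - v \<in> W) \<and> (\<forall>v\<in>W. p v = 0))"

context vector_space
begin

lemma quot_exists:
  assumes "subspace W"
  shows "\<exists>p. Vector_Spaces.linear scale scale p \<and> (\<forall>v. p v - v \<in> W) \<and> (\<forall>v\<in>W. p v = 0)"
proof -
  interpret vector_space_pair scale scale by unfold_locales
  obtain B where B: "B \<subseteq> W" "independent B" "W \<subseteq> span B"
    by (rule basis_exists[of W])
  have sB: "span B = W" by (rule span_subspace[OF B(1,3) assms])
  define C where "C = extend_basis B"
  have C: "independent C" "span C = UNIV" "B \<subseteq> C"
    unfolding C_def using independent_extend_basis[OF B(2)] span_extend_basis[OF B(2)]
      extend_basis_superset[OF B(2)] by simp_all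
  obtain p where p: "Vector_Spaces.linear scale scale p" "\<forall>x\<in>C. p x = (if x \<in> B then 0 else x)"
    using linear_independent_extend[OF C(1), of "\<lambda>x. if x \<in> B then 0 else x"] by blast
  interpret p: Vector_Spaces.linear scale scale p by (rule p(1))
  have "p v - v \<in> W" for v
  proof -
    have "v \<in> span C" using C by simp
    then show ?thesis
    proof (induction rule: span_induct_alt)
      case base then show ?case using p.zero subspace_0[OF assms] by simp
    next
      case (step c x y)
      have "p x - x \<in> W"
      proof (cases "x \<in> B")
        case True
        then have "x \<in> W" using B(1) by blast
        then show ?thesis using True step(1) p(2) subspace_neg[OF assms] by simp
      next
        case False
        then show ?thesis using step(1) p(2) subspace_0[OF assms] by simp
      qed
      then have "c *s (p x - x) + (p y - y) \<in> W"
        using step(2) by (intro subspace_add[OF assms] subspace_scale[OF assms])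
      moreover have "p (c *s x + y) - (c *s x + y) = c *s (p x - x) + (p y - y)"
        by (simp add: p.add p.scale scale_right_diff_distrib)
      ultimately show ?case by (simp only:)
    qed
  qed
  moreover have "p v = 0" if "v \<in> W" for v
  proof -
    have "v \<in> span B" using that sB by simp
    then show ?thesis
    proof (induction rule: span_induct_alt)
      case base then show ?case by (rule p.zero)
    next
      case (step c x y)
      then have "p x = 0" using p(2) C(3) by auto
      then show ?case using step(2) by (simp only: p.add p.scale scale_zero_right add_0)
    qed
  qed
  ultimately show ?thesis using p(1) by blast
qed

lemma
  assumes "subspace W"
  shows linear_quot: "Vector_Spaces.linear scale scale (quot scale W)"
    and quot_diff: "quot scale W v - v \<in> W"
    and quot_zero: "v \<in> W \<Longrightarrow> quot scale W v = 0"
proof -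
  note q = someI_ex[OF quot_exists[OF assms], folded quot_def]
  show "Vector_Spaces.linear scale scale (quot scale W)" by (rule conjunct1[OF q])
  show "quot scale W v - v \<in> W" using q by simp
  show "v \<in> W \<Longrightarrow> quot scale W v = 0" using q by simp
qed

lemma quot_eq_iff:
  assumes "subspace W"
  shows "quot scale W x = quot scale W y \<longleftrightarrow> x - y \<in> W"
proof -
  interpret q: Vector_Spaces.linear scale scale "quot scale W" by (rule linear_quot[OF assms])
  have "v \<in> W" if "quot scale W v = 0" for v
  proof -
    have "- v \<in> W" using quot_diff[OF assms, of v] that by simp
    then show ?thesis using subspace_neg[OF assms] by fastforce
  qed
  then have "quot scale W (x - y) = 0 \<longleftrightarrow> x - y \<in> W"
    using quot_zero[OF assms] by blast
  then show ?thesis by (simp add: q.diff)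
qed

end

text \<open>
  \<open>'x \<Rightarrow>\<^sub>0 'k\<close> is the free vector space on the type \<open>'x\<close>, with scalar multiplication \<open>fscale\<close> and basis
  \<open>gen x\<close>; \<open>lin_ext sc f\<close> is the linear extension of \<open>f\<close> to it.
\<close>

definition fscale :: "'k::field \<Rightarrow> ('x \<Rightarrow>\<^sub>0 'k) \<Rightarrow> ('x \<Rightarrow>\<^sub>0 'k)" where
  "fscale c p = Poly_Mapping.map ((*) c) p"

lemma lookup_fscale [simp]: "Poly_Mapping.lookup (fscale c p) x = c * Poly_Mapping.lookup p x"
  by (simp add: fscale_def Poly_Mapping.map.rep_eq when_def)

global_interpretation free: vector_space "fscale :: 'k::field \<Rightarrow> ('x \<Rightarrow>\<^sub>0 'k) \<Rightarrow> _"
  by unfold_locales (auto intro!: poly_mapping_eqI simp: lookup_add algebra_simps)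

abbreviation gen :: "'x \<Rightarrow> ('x \<Rightarrow>\<^sub>0 'k::field)" where
  "gen x \<equiv> Poly_Mapping.single x 1"

definition lin_ext :: "('k::field \<Rightarrow> 'v::ab_group_add \<Rightarrow> 'v) \<Rightarrow> ('x \<Rightarrow> 'v) \<Rightarrow> ('x \<Rightarrow>\<^sub>0 'k) \<Rightarrow> 'v" where
  "lin_ext sc f p = (\<Sum>x\<in>Poly_Mapping.keys p. sc (Poly_Mapping.lookup p x) (f x))"

definition isomorphic :: "('k::field \<Rightarrow> 'v::ab_group_add \<Rightarrow> 'v) \<Rightarrow> 'v set \<Rightarrow> 'v set \<Rightarrow> bool" where
  "isomorphic sc V W \<longleftrightarrow> (\<exists>\<phi>. bij_betw \<phi> V W \<and>
     (\<forall>x\<in>V. \<forall>y\<in>V. \<phi> (x + y) = \<phi> x + \<phi> y) \<and> (\<forall>c. \<forall>x\<in>V. \<phi> (sc c x) = sc c (\<phi> x)))"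

section \<open>Sequences of coefficients of powers of \<open>t\<close>\<close>

text \<open>A family \<open>x\<close> stands for the possibly infinite sum of the \<open>t\<^sup>i x\<^sub>i\<close> over all integers \<open>i\<close>.\<close>

definition sscale :: "'k::field \<Rightarrow> (int \<Rightarrow> 'x \<Rightarrow>\<^sub>0 'k) \<Rightarrow> (int \<Rightarrow> 'x \<Rightarrow>\<^sub>0 'k)" where
  "sscale c x = (\<lambda>i. fscale c (x i))"

text \<open>
  \<open>tot \<delta> \<epsilon>\<close> is the \<open>t\<close>-linear extension of \<open>\<delta> + t \<epsilon>\<close>, for operators \<open>\<delta>\<close> of degree 1 and \<open>\<epsilon>\<close> of degree -1;
  \<open>t\<close> has degree 2.
\<close>

definition tot :: "('v \<Rightarrow> 'v) \<Rightarrow> ('v \<Rightarrow> 'v) \<Rightarrow> (int \<Rightarrow> 'v) \<Rightarrow> (int \<Rightarrow> 'v::ab_group_add)" where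
  "tot \<delta> \<epsilon> x = (\<lambda>i. \<delta> (x i) + \<epsilon> (x (i - 1)))"

section \<open>Noncommutative differential forms\<close>

text \<open>The sort of \<open>'a\<close> does not include \<open>0 \<noteq> 1\<close>, so that the zero algebra is allowed.\<close>

locale unital_algebra = vector_space scale
  for scale :: "'k::field \<Rightarrow> 'a::{ring,monoid_mult} \<Rightarrow> 'a" (infixr "*s" 75) +
  assumes scale_mult_left: "(c *s x) * y = c *s (x * y)"
    and scale_mult_right: "x * (c *s y) = c *s (x * y)"

type_synonym ('a, 'k) tensor2 = "('a \<times> 'a) \<Rightarrow>\<^sub>0 'k"
type_synonym ('a, 'k) form = "('a \<times> ('a, 'k) tensor2 list) \<Rightarrow>\<^sub>0 'k"

context unital_algebra
begin

subsection \<open>The bimodule of noncommutative one-forms\<close>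

text \<open>\<open>A \<otimes> A\<close> is the quotient of the free vector space on \<open>A \<times> A\<close> by the bilinearity relations.\<close>

definition tensor_rel :: "('a, 'k) tensor2 set" where
  "tensor_rel = free.span
     ({gen (a + b, c) - gen (a, c) - gen (b, c) | a b c. True} \<union>
      {gen (a, b + c) - gen (a, b) - gen (a, c) | a b c. True} \<union>
      {gen (r *s a, b) - fscale r (gen (a, b)) | r a b. True} \<union>
      {gen (a, r *s b) - fscale r (gen (a, b)) | r a b. True})"

definition tens :: "'a \<Rightarrow> 'a \<Rightarrow> ('a, 'k) tensor2" where
  "tens a b = quot fscale tensor_rel (gen (a, b))"

definition tensor_square :: "('a, 'k) tensor2 set" where
  "tensor_square = range (quot fscale tensor_rel)"

text \<open>
  The following three linear maps are given on the free vector space; they respect \<open>tensor_rel\<close>, and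
  on \<open>tensor_square\<close> they are \<open>x \<otimes> y \<mapsto> x y\<close>, \<open>x \<otimes> y \<mapsto> a x \<otimes> y\<close> and \<open>x \<otimes> y \<mapsto> x \<otimes> y a\<close>.
\<close>

definition mult_map :: "('a, 'k) tensor2 \<Rightarrow> 'a" where
  "mult_map = lin_ext scale (\<lambda>(x, y). x * y)"

definition lact :: "'a \<Rightarrow> ('a, 'k) tensor2 \<Rightarrow> ('a, 'k) tensor2" where
  "lact a = lin_ext fscale (\<lambda>(x, y). tens (a * x) y)"

definition ract :: "('a, 'k) tensor2 \<Rightarrow> 'a \<Rightarrow> ('a, 'k) tensor2" where
  "ract m a = lin_ext fscale (\<lambda>(x, y). tens x (y * a)) m"

definition Omega1 :: "('a, 'k) tensor2 set" where
  "Omega1 = {m \<in> tensor_square. mult_map m = 0}"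

definition d1 :: "'a \<Rightarrow> ('a, 'k) tensor2" where
  "d1 a = tens 1 a - tens a 1"

subsection \<open>The tensor algebra of the bimodule of one-forms\<close>

text \<open>
  The degree \<open>n\<close> part of the tensor algebra over \<open>A\<close> of \<open>M = Omega1\<close> is taken to be
  \<open>A \<otimes>\<^sub>A M \<otimes>\<^sub>A \<dots> \<otimes>\<^sub>A M\<close> with \<open>n\<close> factors \<open>M\<close>, which for \<open>n = 0\<close> is \<open>A\<close>.  A generator \<open>(a, [m\<^sub>1, \<dots>, m\<^sub>n])\<close>
  of the free vector space stands for \<open>a \<otimes> m\<^sub>1 \<otimes> \<dots> \<otimes> m\<^sub>n\<close>; the relations are multilinearity over the
  field and \<open>A\<close>-balancedness.
\<close>

definition forms_rel :: "('a, 'k) form set" where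
  "forms_rel = free.span
     ({gen (a + b, ms) - gen (a, ms) - gen (b, ms) | a b ms. set ms \<subseteq> Omega1} \<union>
      {gen (r *s a, ms) - fscale r (gen (a, ms)) | r a ms. set ms \<subseteq> Omega1} \<union>
      {gen (a, us @ (x + y) # vs) - gen (a, us @ x # vs) - gen (a, us @ y # vs) | a us x y vs.
         set us \<union> {x, y} \<union> set vs \<subseteq> Omega1} \<union>
      {gen (a, us @ fscale r x # vs) - fscale r (gen (a, us @ x # vs)) | r a us x vs.
         set us \<union> {x} \<union> set vs \<subseteq> Omega1} \<union>
      {gen (a * b, x # vs) - gen (a, lact b x # vs) | a b x vs.
         {x} \<union> set vs \<subseteq> Omega1} \<union>
      {gen (a, us @ ract x b # y # vs) - gen (a, us @ x # lact b y # vs) | a b us x y vs.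
         set us \<union> {x, y} \<union> set vs \<subseteq> Omega1})"

definition pure :: "'a \<Rightarrow> ('a, 'k) tensor2 list \<Rightarrow> ('a, 'k) form" where
  "pure a ms = quot fscale forms_rel (gen (a, ms))"

definition Omega_deg :: "nat \<Rightarrow> ('a, 'k) form set" where
  "Omega_deg n = free.span {pure a ms | a ms. length ms = n \<and> set ms \<subseteq> Omega1}"

definition Omega :: "('a, 'k) form set" where
  "Omega = free.span (\<Union>n. Omega_deg n)"

text \<open>
  The product is \<open>(a \<otimes> m\<^sub>1 \<otimes> \<dots> \<otimes> m\<^sub>p)(b \<otimes> n\<^sub>1 \<otimes> \<dots> \<otimes> n\<^sub>q) = a \<otimes> m\<^sub>1 \<otimes> \<dots> \<otimes> m\<^sub>p b \<otimes> n\<^sub>1 \<otimes> \<dots> \<otimes> n\<^sub>q\<close>,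
  extended bilinearly.
\<close>

fun pure_mult :: "'a \<times> ('a, 'k) tensor2 list \<Rightarrow> 'a \<times> ('a, 'k) tensor2 list \<Rightarrow> ('a, 'k) form" where
  "pure_mult (a, ms) (b, ns) =
     (if ms = [] then pure (a * b) ns else pure a (butlast ms @ ract (last ms) b # ns))"

definition wmult :: "('a, 'k) form \<Rightarrow> ('a, 'k) form \<Rightarrow> ('a, 'k) form" (infixl "\<odot>" 70) where
  "\<alpha> \<odot> \<beta> = lin_ext fscale (\<lambda>u. lin_ext fscale (\<lambda>v. pure_mult u v) \<beta>) \<alpha>"

definition emb :: "'a \<Rightarrow> ('a, 'k) form" where
  "emb a = pure a []"

definition dd :: "'a \<Rightarrow> ('a, 'k) form" where
  "dd a = pure 1 [d1 a]"

text \<open>\<open>dprod [a\<^sub>1, \<dots>, a\<^sub>n]\<close> is \<open>da\<^sub>1 \<cdots> da\<^sub>n\<close>, and \<open>nform a\<^sub>0 [a\<^sub>1, \<dots>, a\<^sub>n]\<close> is \<open>a\<^sub>0 da\<^sub>1 \<cdots> da\<^sub>n\<close>.\<close>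

definition dprod :: "'a list \<Rightarrow> ('a, 'k) form" where
  "dprod as = foldr (\<lambda>a w. dd a \<odot> w) as (emb 1)"

definition nform :: "'a \<Rightarrow> 'a list \<Rightarrow> ('a, 'k) form" where
  "nform a as = emb a \<odot> dprod as"

definition comm :: "('a, 'k) form \<Rightarrow> ('a, 'k) form \<Rightarrow> ('a, 'k) form" where
  "comm \<alpha> \<beta> = \<alpha> \<odot> \<beta> - \<beta> \<odot> \<alpha>"

subsection \<open>Operators on forms\<close>

text \<open>
  Each operator is a linear endomorphism of the ambient space, and its values on \<open>Omega\<close> are
  determined by the stated conditions; only these values are used.
\<close>

text \<open>The differential of the DG algebra of forms: the odd derivation of square zero with \<open>a \<mapsto> da\<close>.\<close>

definition d_op :: "('a, 'k) form \<Rightarrow> ('a, 'k) form" where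
  "d_op = (SOME g. Vector_Spaces.linear fscale fscale g \<and>
     (\<forall>a. g (emb a) = dd a) \<and>
     (\<forall>n. \<forall>\<alpha>\<in>Omega_deg n. \<forall>\<beta>\<in>Omega. g (\<alpha> \<odot> \<beta>) = g \<alpha> \<odot> \<beta> + fscale ((-1) ^ n) (\<alpha> \<odot> g \<beta>)) \<and>
     (\<forall>\<alpha>\<in>Omega. g (g \<alpha>) = 0))"

definition iota_op :: "('a, 'k) form \<Rightarrow> ('a, 'k) form" where
  "iota_op = (SOME g. Vector_Spaces.linear fscale fscale g \<and>
     (\<forall>a. g (emb a) = 0) \<and>
     (\<forall>n as. n \<ge> 1 \<longrightarrow> length as = n + 1 \<longrightarrow>
        g (nform (as ! 0) (tl as)) =
          (\<Sum>k=1..n. fscale ((-1) ^ ((k - 1) * (n - 1)))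
             (comm (emb (as ! k))
                   (dprod (drop (k + 1) as) \<odot> emb (as ! 0) \<odot> dprod (take (k - 1) (tl as)))))))"

definition b_op :: "('a, 'k) form \<Rightarrow> ('a, 'k) form" where
  "b_op = (SOME g. Vector_Spaces.linear fscale fscale g \<and>
     (\<forall>a. g (emb a) = 0) \<and>
     (\<forall>n a. \<forall>\<alpha>\<in>Omega_deg n. g (\<alpha> \<odot> dd a) = fscale ((-1) ^ n) (comm \<alpha> (emb a))))"

definition B_op :: "('a, 'k) form \<Rightarrow> ('a, 'k) form" where
  "B_op = (SOME g. Vector_Spaces.linear fscale fscale g \<and>
     (\<forall>n as. length as = n + 1 \<longrightarrow>
        g (nform (as ! 0) (tl as)) =
          (\<Sum>i=0..n. fscale ((-1) ^ (n * i)) (dprod (drop i as @ take i as)))))"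

subsection \<open>Reduced forms and the completed complexes\<close>

text \<open>
  The reduced forms are the quotient of all forms by the scalars in degree 0; in positive degrees this
  quotient changes nothing.  An operator that maps scalars to scalars induces \<open>red_op f\<close>.
\<close>

definition red :: "('a, 'k) form \<Rightarrow> ('a, 'k) form" where
  "red = quot fscale (free.span {emb 1})"

definition red_Omega :: "int \<Rightarrow> ('a, 'k) form set" where
  "red_Omega n = (if n \<ge> 0 then red ` Omega_deg (nat n) else {0})"

definition red_op :: "(('a, 'k) form \<Rightarrow> ('a, 'k) form) \<Rightarrow> ('a, 'k) form \<Rightarrow> ('a, 'k) form" where
  "red_op f \<alpha> = red (f \<alpha>)"

definition chains :: "int \<Rightarrow> (int \<Rightarrow> ('a, 'k) form) set" where
  "chains n = {x. \<forall>i. x i \<in> red_Omega (n - 2 * i)}"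

definition homology :: "(('a, 'k) form \<Rightarrow> ('a, 'k) form) \<Rightarrow> (('a, 'k) form \<Rightarrow> ('a, 'k) form) \<Rightarrow>
    int \<Rightarrow> (int \<Rightarrow> ('a, 'k) form) set" where
  "homology \<delta> \<epsilon> n = quot sscale (tot \<delta> \<epsilon> ` chains (n - 1)) ` {x \<in> chains n. tot \<delta> \<epsilon> x = 0}"

text \<open>The reduced periodic cyclic homology \<open>HP\<^sub>m(A)\<close>, where \<open>HP\<^sub>-\<^sub>n\<close> is the cohomology in degree \<open>n\<close>.\<close>

definition HP :: "int \<Rightarrow> (int \<Rightarrow> ('a, 'k) form) set" where
  "HP m = homology (red_op B_op) (red_op b_op) (- m)"

end

end

theory Submission
  imports Defs
begin

text \<open>
  Let \<open>\<kappa> = 1 - bd - db\<close> be the Karoubi operator and \<open>N\<^sub>m = 1 + \<kappa> + \<dots> + \<kappa>\<^sup>m\<^sup>-\<^sup>1\<close>.  In degree \<open>n\<close> one has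
  \<open>B = N\<^sub>n\<^sub>+\<^sub>1 d\<close>, \<open>\<iota> = - b N\<^sub>n\<close> and \<open>\<kappa>\<^sup>n = 1 + b \<kappa>\<^sup>n d\<close>; the last identity gives \<open>b \<kappa>\<^sup>n = b\<close> and \<open>\<kappa>\<^sup>n\<^sup>+\<^sup>1 d = d\<close>.
  Hence \<open>(n-1)! N\<^sub>n\<close> and \<open>N\<^sub>n\<^sub>+\<^sub>1 / (n+1)!\<close>, with the sign \<open>(-1)\<^sup>i\<close> on \<open>t\<^sup>i\<close>, are chain maps between the two
  complexes in opposite directions.  Their composite differs from 1 by \<open>(bd + db) s\<close> for a polynomial
  \<open>s\<close> in \<open>\<kappa>\<close>.  A cycle \<open>x\<close> of \<open>d + t \<iota>\<close> satisfies \<open>bdx = 0\<close>, and \<open>db s x\<close> is the boundary of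
  \<open>b s x\<close>; a cycle of \<open>B + t b\<close> satisfies \<open>dbx = 0\<close>, and \<open>bd s x\<close> is the boundary of \<open>t\<^sup>-\<^sup>1 d s x\<close>.
  So the maps are mutually inverse on homology, and no harmonic decomposition is needed.
\<close>

section \<open>Linear maps between free vector spaces\<close>

text \<open>The norms depend on the degree, so multiplying by them turns one differential into the
  other only up to the scalar by which a second norm acts. Since N_(n+1) dx and N_n bx are fixed by
  \<kappa>, a further norm N_m acts on them as the integer m; the factorials collect these integers
  so that consecutive degrees match, and inverting them is where characteristic 0 enters. The sign
  (-1)^i absorbs the minus sign of \<iota>.

  The larger share of the work lies beneath this algebra. Each operator is chosen as some linear map
  with prescribed values, so nothing is known of it until such a map is shown to exist. The values
  are prescribed on a_0 da_1 ... da_n, whereas a form is by definition a combination of words in a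
  bimodule tensor algebra. It has to be shown that these expressions satisfy no relations beyond
  multilinearity and vanishing when a later entry is 1.\<close>

abbreviation flin :: "(('x \<Rightarrow>\<^sub>0 'k::field) \<Rightarrow> ('y \<Rightarrow>\<^sub>0 'k)) \<Rightarrow> bool" where
  "flin f \<equiv> Vector_Spaces.linear fscale fscale f"

lemma flin_iff: "flin f \<longleftrightarrow> (\<forall>x y. f (x + y) = f x + f y) \<and> (\<forall>c x. f (fscale c x) = fscale c (f x))"
  by (auto simp: Vector_Spaces.linear_iff free.vector_space_axioms)

lemma
  assumes "flin f"
  shows flin_add: "f (x + y) = f x + f y"
    and flin_scale: "f (fscale c x) = fscale c (f x)"
    and flin_diff: "f (x - y) = f x - f y"
    and flin_neg: "f (- x) = - f x"
    and flin_zero: "f 0 = 0"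
    and flin_sum: "f (sum h I) = (\<Sum>i\<in>I. f (h i))"
proof -
  interpret f: Vector_Spaces.linear fscale fscale f by (rule assms)
  show "f (x + y) = f x + f y" "f (fscale c x) = fscale c (f x)" "f (x - y) = f x - f y"
    "f (- x) = - f x" "f 0 = 0" "f (sum h I) = (\<Sum>i\<in>I. f (h i))"
    by (rule f.add f.scale f.diff f.neg f.zero f.sum)+
qed

lemma sum_const_fscale: "(\<Sum>j<m::nat. x) = fscale (of_nat m) x"
  by (induction m) (simp_all add: free.scale_left_distrib)

lemma flin_comp: "flin f \<Longrightarrow> flin g \<Longrightarrow> flin (\<lambda>x. f (g x))"
  by (simp add: flin_iff)

lemma flin_id: "flin (\<lambda>x. x)"
  by (simp add: flin_iff)

lemma flin_plus: "flin f \<Longrightarrow> flin g \<Longrightarrow> flin (\<lambda>x. f x + g x)"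
  by (simp add: flin_iff free.scale_right_distrib algebra_simps)

lemma flin_minus: "flin f \<Longrightarrow> flin g \<Longrightarrow> flin (\<lambda>x. f x - g x)"
  by (simp add: flin_iff free.scale_right_diff_distrib algebra_simps)

lemma flin_uminus: "flin f \<Longrightarrow> flin (\<lambda>x. - f x)"
  by (simp add: flin_iff free.scale_minus_right)

lemma flin_fscale: "flin f \<Longrightarrow> flin (\<lambda>x. fscale c (f x))"
  by (simp add: flin_iff free.scale_right_distrib mult.commute)

lemma flin_setsum: "(\<And>i. i \<in> I \<Longrightarrow> flin (f i)) \<Longrightarrow> flin (\<lambda>x. \<Sum>i\<in>I. f i x)"
  by (simp add: flin_iff sum.distrib free.scale_sum_right)

lemma flin_funpow:
  fixes f :: "('x \<Rightarrow>\<^sub>0 'k::field) \<Rightarrow> ('x \<Rightarrow>\<^sub>0 'k)"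
  assumes "flin f"
  shows "flin (f ^^ n)"
proof (induction n)
  case 0
  then show ?case using flin_id by (simp add: id_def)
next
  case (Suc n)
  then show ?case using flin_comp[OF assms Suc] by (simp add: o_def)
qed

lemma span_into:
  assumes "flin f" "free.subspace W" "x \<in> free.span S" "\<And>x. x \<in> S \<Longrightarrow> f x \<in> W"
  shows "f x \<in> W"
  using assms(3)
proof (induction rule: free.span_induct_alt)
  case base
  then show ?case using assms by (simp add: flin_zero free.subspace_0)
next
  case (step c x y)
  then show ?case using assms
    by (simp add: flin_add flin_scale free.subspace_add free.subspace_scale)
qed

lemma span_eq_on:
  assumes "flin f" "flin g" "x \<in> free.span S" "\<And>x. x \<in> S \<Longrightarrow> f x = g x"
  shows "f x = g x"
  using span_into[OF flin_minus[OF assms(1,2)] free.subspace_single_0 assms(3)] assms(4) by simp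

lemma subspace_flin_image:
  assumes "flin f" "free.subspace U"
  shows "free.subspace (f ` U)"
proof (rule free.subspaceI)
  show "0 \<in> f ` U" using assms by (metis flin_zero free.subspace_0 image_eqI)
  show "x + y \<in> f ` U" if xy: "x \<in> f ` U" "y \<in> f ` U" for x y
  proof -
    obtain u v where "u \<in> U" "v \<in> U" "x = f u" "y = f v" using xy by blast
    then show ?thesis using assms by (simp add: flin_add[symmetric] free.subspace_add)
  qed
  show "fscale c x \<in> f ` U" if x: "x \<in> f ` U" for c x
  proof -
    obtain u where "u \<in> U" "x = f u" using x by blast
    then show ?thesis using assms by (simp add: flin_scale[symmetric] free.subspace_scale)
  qed
qed

lemma span_gen: "p \<in> free.span (range gen)"
proof (induction p rule: update_induct)
  case const
  then show ?case by (rule free.span_zero)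
next
  case (update p a b)
  have "Poly_Mapping.update a b p = p + fscale b (gen a)"
    using update(1) by (intro poly_mapping_eqI)
      (auto simp: lookup_update lookup_add lookup_single when_def in_keys_iff)
  then show ?case using update(3) by (simp add: free.span_add free.span_scale free.span_base)
qed

lemma gens_into:
  assumes "flin f" "free.subspace W" "\<And>x. f (gen x) \<in> W"
  shows "f p \<in> W"
  using span_into[OF assms(1,2) span_gen] assms(3) by blast

lemma gens_eq:
  assumes "flin f" "flin g" "\<And>x. f (gen x) = g (gen x)"
  shows "f p = g p"
  using span_eq_on[OF assms(1,2) span_gen] assms(3) by blast

section \<open>Linear extension from the basis of a free space\<close>

context vector_space
begin

lemma lin_ext_superset:
  assumes "finite S" "Poly_Mapping.keys p \<subseteq> S"
  shows "lin_ext scale f p = (\<Sum>x\<in>S. scale (Poly_Mapping.lookup p x) (f x))"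
  unfolding lin_ext_def
  by (rule sum.mono_neutral_left) (use assms in \<open>auto simp: in_keys_iff\<close>)

lemma linear_lin_ext: "Vector_Spaces.linear fscale scale (lin_ext scale f)"
proof -
  have "lin_ext scale f (p + q) = lin_ext scale f p + lin_ext scale f q" for p q
    using Poly_Mapping.keys_add[of p q]
    by (subst (1 2 3) lin_ext_superset[of "Poly_Mapping.keys p \<union> Poly_Mapping.keys q"])
      (auto simp: lookup_add scale_left_distrib sum.distrib)
  moreover have "lin_ext scale f (fscale c p) = scale c (lin_ext scale f p)" for c p
    by (subst (1 2) lin_ext_superset[of "Poly_Mapping.keys p"])
      (auto simp: scale_sum_right in_keys_iff)
  ultimately show ?thesis
    by (simp add: Vector_Spaces.linear_iff free.vector_space_axioms vector_space_axioms)
qed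

lemma lin_ext_gen [simp]: "lin_ext scale f (gen x) = f x"
  by (subst lin_ext_superset[of "{x}"]) (auto simp: lookup_single)

end

lemmas flin_lin_ext = free.linear_lin_ext

lemma flin_lin_ext_fun:
  assumes "\<And>x. flin (f x)"
  shows "flin (\<lambda>c. lin_ext fscale (\<lambda>x. f x c) p)"
  unfolding lin_ext_def by (intro flin_setsum flin_fscale assms)

lemmas flin_quot = free.linear_quot

lemma flin_quot_diff:
  assumes "free.subspace R" "flin f" "\<And>x. x \<in> R \<Longrightarrow> f x \<in> W"
  shows "f (quot fscale R x) - f x \<in> W"
  using assms(3)[OF free.quot_diff[OF assms(1), of x]] by (simp add: flin_diff[OF assms(2)])

text \<open>A normal form differs from its argument by a relation, so a map that kills the relations
  cannot tell them apart. Maps out of a quotient are therefore never lifted: the map on the free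
  space is applied to normal forms.\<close>

lemma flin_quot_eq:
  assumes "free.subspace R" "flin f" "\<And>x. x \<in> R \<Longrightarrow> f x = 0"
  shows "f (quot fscale R x) = f x"
  using flin_quot_diff[OF assms(1,2), of "{0}"] assms(3) by simp

section \<open>Complexes with a Karoubi operator\<close>

global_interpretation seqs: vector_space "sscale :: 'k::field \<Rightarrow> (int \<Rightarrow> 'x \<Rightarrow>\<^sub>0 'k) \<Rightarrow> _"
  by unfold_locales
    (auto simp: sscale_def fun_eq_iff free.scale_right_distrib free.scale_left_distrib)

text \<open>Classes are their own representatives, so the isomorphism sends a normal form q to the
  normal form of \<open>F q\<close>; another representative of q changes \<open>F q\<close> by an
  element of \<open>R'\<close>. As \<open>F\<close> and \<open>G\<close> are inverse only modulo
  \<open>R\<close> and \<open>R'\<close>, \<open>GF\<close> yields injectivity and \<open>FG\<close>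
  surjectivity.\<close>

lemma (in vector_space) isomorphic_quotients:
  assumes sub: "subspace Z" "subspace Z'" "subspace R" "subspace R'"
    and lin: "Vector_Spaces.linear scale scale F" "Vector_Spaces.linear scale scale G"
    and FZ: "\<And>x. x \<in> Z \<Longrightarrow> F x \<in> Z'" and FR: "\<And>x. x \<in> R \<Longrightarrow> F x \<in> R'"
    and GZ: "\<And>x. x \<in> Z' \<Longrightarrow> G x \<in> Z" and GR: "\<And>x. x \<in> R' \<Longrightarrow> G x \<in> R"
    and GF: "\<And>x. x \<in> Z \<Longrightarrow> x - G (F x) \<in> R" and FG: "\<And>x. x \<in> Z' \<Longrightarrow> x - F (G x) \<in> R'"
  shows "isomorphic scale (quot scale R ` Z) (quot scale R' ` Z')"
proof -
  interpret F: Vector_Spaces.linear scale scale F by (rule lin)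
  interpret G: Vector_Spaces.linear scale scale G by (rule lin)
  interpret q': Vector_Spaces.linear scale scale "quot scale R'" by (rule linear_quot[OF sub(4)])
  let ?\<phi> = "\<lambda>q. quot scale R' (F q)"
  have \<phi>: "?\<phi> (quot scale R z) = quot scale R' (F z)" for z
    unfolding quot_eq_iff[OF sub(4)] F.diff[symmetric] by (rule FR[OF quot_diff[OF sub(3)]])
  have "inj_on ?\<phi> (quot scale R ` Z)"
  proof (rule inj_onI; elim imageE; hypsubst)
    fix z w assume zw: "z \<in> Z" "w \<in> Z" and eq: "?\<phi> (quot scale R z) = ?\<phi> (quot scale R w)"
    have "F (z - w) \<in> R'" using eq by (simp add: \<phi> quot_eq_iff[OF sub(4)] F.diff)
    then have "G (F (z - w)) \<in> R" by (rule GR)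
    moreover have "z - w \<in> Z" using zw by (rule subspace_diff[OF sub(1)])
    ultimately have "(z - w - G (F (z - w))) + G (F (z - w)) \<in> R"
      by (intro subspace_add[OF sub(3)] GF)
    then show "quot scale R z = quot scale R w" by (simp add: quot_eq_iff[OF sub(3)])
  qed
  moreover have "?\<phi> ` quot scale R ` Z = quot scale R' ` Z'"
  proof
    show "?\<phi> ` quot scale R ` Z \<subseteq> quot scale R' ` Z'" using FZ by (auto simp: \<phi>)
    have "quot scale R' w = ?\<phi> (quot scale R (G w))" if "w \<in> Z'" for w
      using FG[OF that] by (simp add: \<phi> quot_eq_iff[OF sub(4)])
    then show "quot scale R' ` Z' \<subseteq> ?\<phi> ` quot scale R ` Z" using GZ by blast
  qed
  ultimately show ?thesis
    unfolding isomorphic_def bij_betw_def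
    by (intro exI[of _ ?\<phi>]) (simp add: F.add F.scale q'.add q'.scale)
qed

abbreviation slin :: "((int \<Rightarrow> 'x \<Rightarrow>\<^sub>0 'k::field) \<Rightarrow> (int \<Rightarrow> 'y \<Rightarrow>\<^sub>0 'k)) \<Rightarrow> bool" where
  "slin f \<equiv> Vector_Spaces.linear sscale sscale f"

lemma slin_iff:
  "slin f \<longleftrightarrow> (\<forall>x y. f (x + y) = f x + f y) \<and> (\<forall>c x. f (sscale c x) = sscale c (f x))"
  by (simp add: Vector_Spaces.linear_iff seqs.vector_space_axioms)

lemma slin_tot: "flin \<delta> \<Longrightarrow> flin \<epsilon> \<Longrightarrow> slin (tot \<delta> \<epsilon>)"
  unfolding slin_iff
  by (simp add: tot_def sscale_def flin_add flin_scale fun_eq_iff free.scale_right_distrib)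

text \<open>The Karoubi operator takes both differentials as arguments because it is formed on all
  forms as well as on reduced forms.\<close>

definition kop :: "('v \<Rightarrow> 'v) \<Rightarrow> ('v \<Rightarrow> 'v) \<Rightarrow> 'v \<Rightarrow> 'v::ab_group_add" where
  "kop b d x = x - b (d x) - d (b x)"

text \<open>What the comparison of the two complexes uses of noncommutative forms. The identities
  are required on the graded pieces only, since nothing is known of the operators elsewhere in the
  ambient space. Degrees are integers, with zero pieces below 0, because k - 2i may be negative for
  the coefficient of t^i.\<close>

locale karoubi_complex =
  fixes U :: "int \<Rightarrow> ('x \<Rightarrow>\<^sub>0 'k::field_char_0) set"
    and d b B \<iota> :: "('x \<Rightarrow>\<^sub>0 'k) \<Rightarrow> ('x \<Rightarrow>\<^sub>0 'k)"
  assumes subspace_U: "free.subspace (U k)"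
    and U_neg: "k < 0 \<Longrightarrow> U k = {0}"
    and flin_d: "flin d" and flin_b: "flin b" and flin_B: "flin B" and flin_\<iota>: "flin \<iota>"
    and d_U: "x \<in> U k \<Longrightarrow> d x \<in> U (k + 1)" and b_U: "x \<in> U k \<Longrightarrow> b x \<in> U (k - 1)"
    and d_d: "x \<in> U k \<Longrightarrow> d (d x) = 0" and b_b: "x \<in> U k \<Longrightarrow> b (b x) = 0"
    and kop_pow: "x \<in> U (int n) \<Longrightarrow> (kop b d ^^ n) x = x + b ((kop b d ^^ n) (d x))"
    and B_eq: "x \<in> U (int n) \<Longrightarrow> B x = (\<Sum>j<Suc n. (kop b d ^^ j) (d x))"
    and \<iota>_eq: "x \<in> U (int n) \<Longrightarrow> \<iota> x = - b (\<Sum>j<n. (kop b d ^^ j) x)"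
begin

abbreviation "K \<equiv> kop b d"

section \<open>Norms of the Karoubi operator and the two differentials\<close>

definition "N m x = (\<Sum>j<m. (K ^^ j) x)"

lemmas U_add = free.subspace_add[OF subspace_U]
  and U_diff = free.subspace_diff[OF subspace_U]
  and U_scale = free.subspace_scale[OF subspace_U]
  and U_sum = free.subspace_sum[OF subspace_U]
  and U_zero [simp] = free.subspace_0[OF subspace_U]

lemma flin_K: "flin K"
  unfolding kop_def
  by (intro flin_minus flin_id flin_comp[OF flin_b flin_d] flin_comp[OF flin_d flin_b])

lemmas flin_Kpow = flin_funpow[OF flin_K]

lemma flin_N: "flin (N m)"
  unfolding N_def by (rule flin_setsum) (rule flin_Kpow)

lemmas zeros [simp] = flin_zero[OF flin_d] flin_zero[OF flin_b] flin_zero[OF flin_B]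
  flin_zero[OF flin_\<iota>] flin_zero[OF flin_N]

lemma K_U: "x \<in> U k \<Longrightarrow> K x \<in> U k"
  using d_U[OF b_U, of x k] b_U[OF d_U, of x k] by (simp add: kop_def U_diff)

lemma d_K: "x \<in> U k \<Longrightarrow> d (K x) = K (d x)"
  by (simp add: kop_def flin_diff[OF flin_d] d_d d_d[OF b_U])

lemma b_K: "x \<in> U k \<Longrightarrow> b (K x) = K (b x)"
  by (simp add: kop_def flin_diff[OF flin_b] b_b b_b[OF d_U])

lemma Kpow_U: "x \<in> U k \<Longrightarrow> (K ^^ j) x \<in> U k"
  by (induction j) (simp_all add: K_U)

lemma d_Kpow: "x \<in> U k \<Longrightarrow> d ((K ^^ j) x) = (K ^^ j) (d x)"
  by (induction j) (simp_all add: d_K[OF Kpow_U])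

lemma b_Kpow: "x \<in> U k \<Longrightarrow> b ((K ^^ j) x) = (K ^^ j) (b x)"
  by (induction j) (simp_all add: b_K[OF Kpow_U])

lemma N_U: "x \<in> U k \<Longrightarrow> N m x \<in> U k"
  unfolding N_def by (rule U_sum) (rule Kpow_U)

lemma d_N: "x \<in> U k \<Longrightarrow> d (N m x) = N m (d x)"
  by (simp add: N_def flin_sum[OF flin_d] d_Kpow)

lemma b_N: "x \<in> U k \<Longrightarrow> b (N m x) = N m (b x)"
  by (simp add: N_def flin_sum[OF flin_b] b_Kpow)

lemma N_commute: "N m (N l x) = N l (N m x)"
proof -
  have "(K ^^ i) ((K ^^ j) x) = (K ^^ j) ((K ^^ i) x)" for i j
    by (metis add.commute comp_apply funpow_add)
  then show ?thesis unfolding N_def flin_sum[OF flin_Kpow] by (subst sum.swap) simp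
qed

text \<open>A telescoping sum: (1 - K) N_m = 1 - K^m. A vector fixed by \<open>K ^^ m\<close> thus
  has a norm \<open>N m x\<close> fixed by \<open>K\<close>.\<close>

lemma K_N: "N m x - K (N m x) = x - (K ^^ m) x"
proof (induction m)
  case 0
  then show ?case by (simp add: N_def flin_zero[OF flin_K])
next
  case (Suc m)
  have "N (Suc m) x - K (N (Suc m) x) = (N m x - K (N m x)) + ((K ^^ m) x - (K ^^ Suc m) x)"
    by (simp add: N_def flin_add[OF flin_K])
  then show ?case by (simp only: Suc) simp
qed

lemma N_fixed:
  assumes "K x = x"
  shows "N m x = fscale (of_nat m) x"
proof -
  have "(K ^^ j) x = x" for j by (induction j) (simp_all add: assms)
  then show ?thesis by (simp add: N_def sum_const_fscale)
qed

lemma Kpow_b: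
  assumes "x \<in> U (int n)"
  shows "(K ^^ n) (b x) = b x"
proof -
  have "b (b ((K ^^ n) (d x))) = 0" by (rule b_b[OF Kpow_U[OF d_U[OF assms]]])
  then have "b ((K ^^ n) x) = b x" by (simp add: kop_pow[OF assms] flin_add[OF flin_b])
  then show ?thesis by (simp add: b_Kpow[OF assms])
qed

text \<open>Put y = K^n dx. Applying d to \<open>kop_pow\<close> gives y = dx + dby, and dy = 0
  gives Ky = y - dby. Hence one further power of K turns y into dx.\<close>

lemma Kpow_d:
  assumes "x \<in> U (int n)"
  shows "(K ^^ Suc n) (d x) = d x"
proof -
  define y where "y = (K ^^ n) (d x)"
  have "d y = 0"
    by (simp add: y_def d_d[OF assms] flin_zero[OF flin_Kpow] d_Kpow[OF d_U[OF assms]])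
  then have Ky: "K y = y - d (b y)" by (simp add: kop_def)
  have "y = d ((K ^^ n) x)" by (simp add: y_def d_Kpow[OF assms])
  also have "\<dots> = d x + d (b y)" by (simp add: y_def kop_pow[OF assms] flin_add[OF flin_d])
  finally have "y - d (b y) = d x" by (metis add_diff_cancel_right')
  then show ?thesis using Ky by (simp add: y_def)
qed

text \<open>The norm is fixed by \<open>K\<close> because \<open>K ^^ n\<close> fixes
  \<open>b x\<close>, so any further norm \<open>N m\<close> multiplies it by m. This and its
  counterpart for d supply the integers from which the factorials are built.\<close>

lemma K_N_b: "x \<in> U (int n) \<Longrightarrow> K (N n (b x)) = N n (b x)"
  using K_N[of n "b x"] by (simp add: Kpow_b)

lemma K_N_d: "x \<in> U (int n) \<Longrightarrow> K (N (Suc n) (d x)) = N (Suc n) (d x)"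
  using K_N[of "Suc n" "d x"] by (simp add: Kpow_d del: funpow.simps)

lemma B_N: "x \<in> U (int n) \<Longrightarrow> B x = N (Suc n) (d x)"
  by (simp add: B_eq N_def)

lemma \<iota>_N: "x \<in> U (int n) \<Longrightarrow> \<iota> x = - N n (b x)"
  by (simp add: \<iota>_eq N_def flin_sum[OF flin_b] b_Kpow)

lemma U_cases:
  assumes "x \<in> U k" "x = 0 \<Longrightarrow> P" "\<And>n. k = int n \<Longrightarrow> x \<in> U (int n) \<Longrightarrow> P"
  shows P
proof (cases "k < 0")
  case True
  then show P using assms(1,2) U_neg by auto
next
  case False
  then show P using assms(1) assms(3)[of "nat k"] by simp
qed

text \<open>Needed for the homotopies: in a cycle of d + t \<iota> one has dx_i = - \<iota> x_(i-1),
  which b kills; and \<iota> kills cycles of b, in particular the image of b, so the correcting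
  boundary involves d alone. The facts on B exchange the roles of b and d.\<close>

lemma b_\<iota>: "x \<in> U k \<Longrightarrow> b (\<iota> x) = 0"
  by (erule U_cases) (simp_all add: \<iota>_N flin_neg[OF flin_b] b_N[OF b_U] b_b)

lemma \<iota>_of_b_zero: "x \<in> U k \<Longrightarrow> b x = 0 \<Longrightarrow> \<iota> x = 0"
  by (erule U_cases) (simp_all add: \<iota>_N)

lemma d_B: "x \<in> U k \<Longrightarrow> d (B x) = 0"
  by (erule U_cases) (simp_all add: B_N d_N[OF d_U] d_d)

lemma B_of_d_zero: "x \<in> U k \<Longrightarrow> d x = 0 \<Longrightarrow> B x = 0"
  by (erule U_cases) (simp_all add: B_N)

lemma b_zero: "x \<in> U 0 \<Longrightarrow> b x = 0"
  using b_U[of x 0] U_neg[of "-1"] by simp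

text \<open>
  On the generalised eigenspace of \<open>K\<close> for the eigenvalue 1 one has \<open>B = (n + 1) d\<close> and \<open>\<iota> = - n b\<close>
  in degree \<open>n\<close>, so \<open>n!\<close> intertwines the two differentials up to the sign of \<open>t\<close>.  The operators
  \<open>up n\<close> and \<open>down n\<close> are \<open>n!\<close> and \<open>1/n!\<close> times \<open>N n / n\<close> and \<open>N (n + 1) / (n + 1)\<close>, which
  are the identity on that eigenspace up to a nilpotent.
\<close>

definition "up n x = (if n = 0 then x else fscale (fact (n - 1)) (N n x))"

definition "down n x = fscale (1 / fact (Suc n)) (N (Suc n) x)"

section \<open>The rescaled norms intertwine the differentials\<close>

lemma flin_up: "flin (up n)"
  unfolding up_def by (cases "n = 0") (simp_all add: flin_id flin_fscale[OF flin_N])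

lemma flin_down: "flin (down n)"
  unfolding down_def by (rule flin_fscale[OF flin_N])

lemma up_U: "x \<in> U k \<Longrightarrow> up n x \<in> U k"
  by (simp add: up_def U_scale N_U)

lemma down_U: "x \<in> U k \<Longrightarrow> down n x \<in> U k"
  by (simp add: down_def U_scale N_U)

text \<open>For n > 0 the right side is (n-1)! N_n N_(n+1) dx, and N_n multiplies the K-fixed vector
  N_(n+1) dx by n, which gives n! N_(n+1) dx. Degree 0 is separate because \<open>up 0\<close> is
  the identity and not a multiple of the zero map \<open>N 0\<close>.\<close>

lemma up_d: "x \<in> U k \<Longrightarrow> up (nat (k + 1)) (d x) = B (up (nat k) x)"
proof (erule U_cases)
  fix n assume k: "k = int n" and x: "x \<in> U (int n)"
  show ?thesis
  proof (cases "n = 0")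
    case True
    then show ?thesis using x k B_N[of x 0] by (simp add: up_def)
  next
    case False
    have "B (up n x) = fscale (fact (n - 1)) (N n (N (Suc n) (d x)))"
      using False by (simp add: up_def flin_scale[OF flin_B] B_N[OF N_U[OF x]] d_N[OF x]
          N_commute[of n])
    also have "\<dots> = fscale (fact (n - 1) * of_nat n) (N (Suc n) (d x))"
      by (simp add: N_fixed[OF K_N_d[OF x]])
    also have "fact (n - 1) * of_nat n = (fact n :: 'k)"
      using False by (simp add: fact_reduce[of n] mult.commute)
    finally show ?thesis using k by (simp add: up_def nat_add_distrib)
  qed
qed (simp add: flin_zero[OF flin_up])

text \<open>For n at least 2 the left side is -(n-2)! N_(n-1) N_n bx = -(n-1)! N_n bx. In degrees 0
  and 1 the index n-1 of \<open>up\<close>, cut off at 0, calls for the identity.\<close>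

lemma up_\<iota>: "x \<in> U k \<Longrightarrow> up (nat (k - 1)) (\<iota> x) = - b (up (nat k) x)"
proof (erule U_cases)
  fix n assume k: "k = int n" and x: "x \<in> U (int n)"
  show ?thesis
  proof (cases n)
    case 0
    then show ?thesis using x k \<iota>_N[of x 0] by (simp add: up_def b_zero)
  next
    case (Suc m)
    show ?thesis
    proof (cases m)
      case 0
      then show ?thesis using x k Suc \<iota>_N[of x 1] by (simp add: up_def N_def)
    next
      case (Suc l)
      have "up m (\<iota> x) = - fscale (fact (m - 1)) (N m (N n (b x)))"
        using Suc by (simp add: up_def \<iota>_N[OF x] flin_neg[OF flin_N] del: fact_Suc)
      also have "\<dots> = - fscale (fact (m - 1) * of_nat m) (N n (b x))"
        by (simp add: N_fixed[OF K_N_b[OF x]])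
      also have "fact (m - 1) * of_nat m = (fact m :: 'k)"
        using Suc by (simp add: fact_reduce[of m] mult.commute)
      finally have "up m (\<iota> x) = - b (up n x)"
        using \<open>n = Suc m\<close> by (simp add: up_def[of "Suc m"] flin_scale[OF flin_b] b_N[OF x])
      moreover have "nat k = n" "nat (k - 1) = m" using k \<open>n = Suc m\<close> by simp_all
      ultimately show ?thesis by simp
    qed
  qed
qed (simp add: flin_zero[OF flin_up])

lemma down_B: "x \<in> U k \<Longrightarrow> down (nat (k + 1)) (B x) = d (down (nat k) x)"
proof (erule U_cases)
  fix n assume k: "k = int n" and x: "x \<in> U (int n)"
  have "down (Suc n) (B x) = fscale (1 / fact (Suc (Suc n)) * of_nat (Suc (Suc n))) (N (Suc n) (d x))"
    by (simp add: down_def B_N[OF x] N_fixed[OF K_N_d[OF x]] del: fact_Suc of_nat_Suc)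
  also have "1 / fact (Suc (Suc n)) * of_nat (Suc (Suc n)) = (1 / fact (Suc n) :: 'k)"
    by (simp add: fact_Suc[of "Suc n"] del: fact_Suc of_nat_Suc)
  finally show ?thesis
    using k by (simp add: down_def flin_scale[OF flin_d] d_N[OF x] nat_add_distrib)
qed (simp add: flin_zero[OF flin_down])

lemma down_b: "x \<in> U k \<Longrightarrow> down (nat (k - 1)) (b x) = - \<iota> (down (nat k) x)"
proof (erule U_cases)
  fix n assume k: "k = int n" and x: "x \<in> U (int n)"
  have "\<iota> (down n x) = - fscale (1 / fact (Suc n)) (N (Suc n) (N n (b x)))"
    by (simp add: down_def flin_scale[OF flin_\<iota>] \<iota>_N[OF N_U[OF x]] b_N[OF x] N_commute[of n]
        free.scale_minus_right del: fact_Suc)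
  also have "\<dots> = - fscale (1 / fact (Suc n) * of_nat (Suc n)) (N n (b x))"
    by (simp add: N_fixed[OF K_N_b[OF x]] del: fact_Suc of_nat_Suc)
  also have "1 / fact (Suc n) * of_nat (Suc n) = (1 / fact n :: 'k)"
    by (simp add: fact_Suc[of n] del: fact_Suc of_nat_Suc)
  finally have *: "\<iota> (down n x) = - fscale (1 / fact n) (N n (b x))" .
  show ?thesis
  proof (cases n)
    case 0
    then show ?thesis using * x k by (simp add: b_zero flin_zero[OF flin_down] N_def)
  next
    case (Suc m)
    then have "nat k = n" "nat (k - 1) = m" using k by simp_all
    then show ?thesis using * Suc by (simp add: down_def[of m] del: fact_Suc)
  qed
qed (simp add: flin_zero[OF flin_down])

lemma up_down: "up n (down n x) = down n (up n x)"
  by (simp add: up_def down_def flin_scale[OF flin_N] N_commute[of n] mult.commute)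

text \<open>Summing (1-K) N_j = 1 - K^j over j < m gives N_m = m - (1-K) S_m with S_m = N_0 + ... +
  N_(m-1). Substituting this in turn for both factors of N_n N_(n+1) leaves n(n+1) plus a multiple
  of 1-K = bd + db. As z is a polynomial in K applied to x, bdz is that polynomial applied to bdx,
  and likewise for db; hence the two implications.\<close>

lemma down_up_homotopy:
  assumes x: "x \<in> U k"
  obtains z where "z \<in> U k" "x - down n (up n x) = b (d z) + d (b z)"
    "b (d x) = 0 \<Longrightarrow> b (d z) = 0" "d (b x) = 0 \<Longrightarrow> d (b z) = 0"
proof -
  define S where "S m y = (\<Sum>j<m. N j y)" for m y
  have S: "N m y = fscale (of_nat m) y - (S m y - K (S m y))" for m y
  proof -
    have "S m y - K (S m y) = (\<Sum>j<m. y - (K ^^ j) y)"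
      by (simp add: S_def flin_sum[OF flin_K] sum_subtractf[symmetric] K_N)
    also have "\<dots> = fscale (of_nat m) y - N m y"
      by (simp add: sum_subtractf N_def sum_const_fscale)
    finally show ?thesis by simp
  qed
  have S_U: "S m y \<in> U l" if "y \<in> U l" for m y l
    unfolding S_def by (rule U_sum) (rule N_U[OF that])
  have bd_S: "b (d (S m y)) = S m (b (d y))" and db_S: "d (b (S m y)) = S m (d (b y))"
    if "y \<in> U l" for m y l
    by (simp_all add: S_def flin_sum[OF flin_b] flin_sum[OF flin_d] d_N[OF that] b_N[OF that]
        b_N[OF d_U[OF that]] d_N[OF b_U[OF that]])
  have bd_N: "b (d (N m y)) = N m (b (d y))" and db_N: "d (b (N m y)) = N m (d (b y))"
    if "y \<in> U l" for m y l
    by (simp_all add: d_N[OF that] b_N[OF that] b_N[OF d_U[OF that]] d_N[OF b_U[OF that]])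
  have S_zero: "S m 0 = 0" for m by (simp add: S_def)
  show thesis
  proof (cases "n = 0")
    case True
    then show thesis using that[of 0] by (simp add: up_def down_def N_def)
  next
    case False
    \<comment> \<open>The scalar in the composite of \<open>down n\<close> and \<open>up n\<close>,
      namely (n-1)!/(n+1)!.\<close>
    define c :: 'k where "c = 1 / (of_nat n * of_nat (Suc n))"
    define z where "z = fscale c (fscale (of_nat n) (S (Suc n) x) + S n (N (Suc n) x))"
    have zU: "z \<in> U k" by (simp add: z_def U_scale U_add S_U N_U x)
    have "fact (Suc n) = of_nat n * of_nat (Suc n) * (fact (n - 1) :: 'k)"
      using False by (simp add: fact_reduce[of n] algebra_simps)
    then have c: "fact (n - Suc 0) / fact (Suc n) = c"
      by (simp add: c_def del: fact_Suc of_nat_Suc)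
    have nz: "of_nat n \<noteq> (0::'k)" "of_nat (Suc n) \<noteq> (0::'k)" using False by (simp, simp del: of_nat_Suc)
    have "down n (up n x) = fscale c (N n (N (Suc n) x))"
      using False by (simp add: up_def down_def flin_scale[OF flin_N] N_commute[of n] c del: fact_Suc)
    also have "N n (N (Suc n) x) = fscale (of_nat n) (N (Suc n) x)
        - (S n (N (Suc n) x) - K (S n (N (Suc n) x)))" by (rule S)
    also have "fscale (of_nat n) (N (Suc n) x) = fscale (of_nat n * of_nat (Suc n)) x
        - (fscale (of_nat n) (S (Suc n) x) - K (fscale (of_nat n) (S (Suc n) x)))"
      unfolding S[of "Suc n" x]
      by (simp add: free.scale_right_diff_distrib flin_scale[OF flin_K] del: of_nat_Suc)
    finally have "down n (up n x) = fscale c (fscale (of_nat n * of_nat (Suc n)) x) - (z - K z)"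
      unfolding z_def flin_scale[OF flin_K] flin_add[OF flin_K]
      by (simp only: free.scale_right_diff_distrib free.scale_right_distrib) (simp add: algebra_simps)
    moreover have "fscale c (fscale (of_nat n * of_nat (Suc n)) x) = x"
      using nz by (simp add: c_def del: of_nat_Suc)
    ultimately have "x - down n (up n x) = b (d z) + d (b z)" by (simp add: kop_def)
    moreover have "b (d z) = fscale c (fscale (of_nat n) (S (Suc n) (b (d x))) + S n (N (Suc n) (b (d x))))"
      "d (b z) = fscale c (fscale (of_nat n) (S (Suc n) (d (b x))) + S n (N (Suc n) (d (b x))))"
      by (simp_all add: z_def flin_scale[OF flin_b] flin_scale[OF flin_d] flin_add[OF flin_b]
          flin_add[OF flin_d] bd_S[OF x] db_S[OF x] bd_S[OF N_U[OF x]] db_S[OF N_U[OF x]]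
          bd_N[OF x] db_N[OF x])
    ultimately show thesis using that[OF zU] by (simp add: S_zero)
  qed
qed

section \<open>Chain maps on the completed complexes\<close>

definition "C k = {x. \<forall>i. x i \<in> U (k - 2 * i)}"

definition esgn :: "int \<Rightarrow> 'k" where "esgn i = (if even i then 1 else - 1)"

text \<open>In total degree k the coefficient of t^i is a form of degree k - 2i, so the operator has
  to know k. Where k - 2i is negative, \<open>nat\<close> returns 0, which is harmless as the
  coefficient of a chain is 0 there.\<close>

definition "Up k x = (\<lambda>i. fscale (esgn i) (up (nat (k - 2 * i)) (x i)))"

definition "Down k x = (\<lambda>i. fscale (esgn i) (down (nat (k - 2 * i)) (x i)))"

lemma slin_Up: "slin (Up k)" and slin_Down: "slin (Down k)"
  unfolding slin_iff
  by (auto simp: Up_def Down_def sscale_def flin_add[OF flin_up] flin_add[OF flin_down]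
      flin_scale[OF flin_up] flin_scale[OF flin_down] fun_eq_iff free.scale_right_distrib mult.commute)

lemma C_D: "x \<in> C k \<Longrightarrow> x i \<in> U (k - 2 * i)"
  by (simp add: C_def)

lemma C_D': "x \<in> C k \<Longrightarrow> x (i - 1) \<in> U (k - 2 * i + 2)"
  using C_D[of x k "i - 1"] by (simp add: algebra_simps)

lemma subspace_C: "seqs.subspace (C k)"
  by (rule seqs.subspaceI) (auto simp: C_def sscale_def U_add U_scale)

lemma Up_C: "x \<in> C k \<Longrightarrow> Up k x \<in> C k"
  and Down_C: "x \<in> C k \<Longrightarrow> Down k x \<in> C k"
  by (simp_all add: C_def Up_def Down_def U_scale up_U down_U)

lemma esgn_simps: "esgn (i - 1) = - esgn i" "esgn i * esgn i = 1"
  by (auto simp: esgn_def)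

text \<open>The d-part stays at t^i, while the \<iota>-part moves from t^(i-1) to t^i; the change of
  \<open>esgn\<close> between the two absorbs the minus sign in \<open>up_\<iota>\<close>.\<close>

lemma Up_tot:
  assumes "x \<in> C k"
  shows "Up (k + 1) (tot d \<iota> x) = tot B b (Up k x)"
proof
  fix i
  have k: "k + 1 - 2 * i = (k - 2 * i) + 1" "k + 1 - 2 * i = (k - 2 * i + 2) - 1"
    "k - 2 * (i - 1) = k - 2 * i + 2" by simp_all
  have "up (nat (k + 1 - 2 * i)) (d (x i)) = B (up (nat (k - 2 * i)) (x i))"
    unfolding k(1) by (rule up_d[OF C_D[OF assms]])
  moreover have "up (nat (k + 1 - 2 * i)) (\<iota> (x (i - 1))) = - b (up (nat (k - 2 * i + 2)) (x (i - 1)))"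
    unfolding k(2) by (rule up_\<iota>[OF C_D'[OF assms]])
  ultimately show "Up (k + 1) (tot d \<iota> x) i = tot B b (Up k x) i"
    unfolding Up_def tot_def k(3)
    by (simp add: flin_add[OF flin_up] esgn_simps flin_scale[OF flin_B] flin_scale[OF flin_b]
        flin_neg[OF flin_b] free.scale_right_diff_distrib del: diff_add_eq diff_diff_eq2)
qed

lemma Down_tot:
  assumes "x \<in> C k"
  shows "Down (k + 1) (tot B b x) = tot d \<iota> (Down k x)"
proof
  fix i
  have k: "k + 1 - 2 * i = (k - 2 * i) + 1" "k + 1 - 2 * i = (k - 2 * i + 2) - 1"
    "k - 2 * (i - 1) = k - 2 * i + 2" by simp_all
  have "down (nat (k + 1 - 2 * i)) (B (x i)) = d (down (nat (k - 2 * i)) (x i))"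
    unfolding k(1) by (rule down_B[OF C_D[OF assms]])
  moreover have "down (nat (k + 1 - 2 * i)) (b (x (i - 1))) = - \<iota> (down (nat (k - 2 * i + 2)) (x (i - 1)))"
    unfolding k(2) by (rule down_b[OF C_D'[OF assms]])
  ultimately show "Down (k + 1) (tot B b x) i = tot d \<iota> (Down k x) i"
    unfolding Down_def tot_def k(3)
    by (simp add: flin_add[OF flin_down] esgn_simps flin_scale[OF flin_d] flin_scale[OF flin_\<iota>]
        flin_neg[OF flin_\<iota>] free.scale_right_diff_distrib del: diff_add_eq diff_diff_eq2)
qed

lemma Down_Up_cycle:
  assumes x: "x \<in> C k" and cycle: "tot d \<iota> x = 0"
  shows "x - Down k (Up k x) \<in> tot d \<iota> ` C (k - 1)"
proof -
  have "\<exists>z. z \<in> U (k - 2 * i) \<and> x i - down (nat (k - 2 * i)) (up (nat (k - 2 * i)) (x i)) = d (b z)"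
    for i
  proof -
    have "d (x i) = - \<iota> (x (i - 1))"
      using fun_cong[OF cycle, of i] by (simp add: tot_def eq_neg_iff_add_eq_0)
    then have "b (d (x i)) = 0" by (simp add: flin_neg[OF flin_b] b_\<iota>[OF C_D[OF x]])
    then show ?thesis
      using down_up_homotopy[OF C_D[OF x, of i], of "nat (k - 2 * i)"] by (metis add_0)
  qed
  \<comment> \<open>The coefficients may be chosen independently of each other, since a chain is an
    arbitrary family in the graded pieces.\<close>
  then obtain z where z: "\<And>i. z i \<in> U (k - 2 * i)"
    "\<And>i. x i - down (nat (k - 2 * i)) (up (nat (k - 2 * i)) (x i)) = d (b (z i))"
    by metis
  have "x - Down k (Up k x) = tot d \<iota> (\<lambda>i. b (z i))"
  proof
    fix i
    have "\<iota> (b (z (i - 1))) = 0" by (rule \<iota>_of_b_zero[OF b_U[OF z(1)] b_b[OF z(1)]])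
    then show "(x - Down k (Up k x)) i = tot d \<iota> (\<lambda>i. b (z i)) i"
      by (simp add: Down_def Up_def tot_def flin_scale[OF flin_down] esgn_simps z(2))
  qed
  moreover have "(\<lambda>i. b (z i)) \<in> C (k - 1)"
    using b_U[OF z(1)] by (simp add: C_def algebra_simps)
  ultimately show ?thesis by blast
qed

lemma Up_Down_cycle:
  assumes x: "x \<in> C k" and cycle: "tot B b x = 0"
  shows "x - Up k (Down k x) \<in> tot B b ` C (k - 1)"
proof -
  have "\<exists>z. z \<in> U (k - 2 * i) \<and> x i - down (nat (k - 2 * i)) (up (nat (k - 2 * i)) (x i)) = b (d z)"
    for i
  proof -
    have "b (x i) = - B (x (i + 1))"
      using fun_cong[OF cycle, of "i + 1"] by (simp add: tot_def eq_neg_iff_add_eq_0 add.commute)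
    then have "d (b (x i)) = 0" by (simp add: flin_neg[OF flin_d] d_B[OF C_D[OF x]])
    then show ?thesis
      using down_up_homotopy[OF C_D[OF x, of i], of "nat (k - 2 * i)"]
      by (metis add.right_neutral)
  qed
  then obtain z where z: "\<And>i. z i \<in> U (k - 2 * i)"
    "\<And>i. x i - down (nat (k - 2 * i)) (up (nat (k - 2 * i)) (x i)) = b (d (z i))"
    by metis
  \<comment> \<open>The shift by one is the factor t^(-1): \<open>tot\<close> feeds b with the
    coefficient at i-1, so that b meets \<open>d (z i)\<close>.\<close>
  have "x - Up k (Down k x) = tot B b (\<lambda>i. d (z (i + 1)))"
  proof
    fix i
    have "B (d (z (i + 1))) = 0" by (rule B_of_d_zero[OF d_U[OF z(1)] d_d[OF z(1)]])
    then show "(x - Up k (Down k x)) i = tot B b (\<lambda>i. d (z (i + 1))) i"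
      by (simp add: Down_def Up_def tot_def flin_scale[OF flin_up] esgn_simps z(2) up_down)
  qed
  moreover have "(\<lambda>i. d (z (i + 1))) \<in> C (k - 1)"
    unfolding C_def
  proof (intro CollectI allI)
    fix i
    show "d (z (i + 1)) \<in> U (k - 1 - 2 * i)"
      using d_U[OF z(1), of "i + 1"] by (simp add: algebra_simps)
  qed
  ultimately show ?thesis by blast
qed

lemma subspace_slin:
  fixes f :: "(int \<Rightarrow> 'x \<Rightarrow>\<^sub>0 'k) \<Rightarrow> (int \<Rightarrow> 'x \<Rightarrow>\<^sub>0 'k)"
  assumes "slin f"
  shows "seqs.subspace {x \<in> C k. f x = 0}" and "seqs.subspace (f ` C k)"
proof -
  interpret f: Vector_Spaces.linear sscale sscale f by (rule assms)
  show "seqs.subspace {x \<in> C k. f x = 0}"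
    using subspace_C[of k] by (auto intro!: seqs.subspaceI simp: f.add f.scale f.zero
        seqs.subspace_add seqs.subspace_scale seqs.subspace_0)
  show "seqs.subspace (f ` C k)" by (rule f.subspace_image[OF subspace_C])
qed

theorem isomorphic_homology:
  "isomorphic sscale
     (quot sscale (tot d \<iota> ` C (k - 1)) ` {x \<in> C k. tot d \<iota> x = 0})
     (quot sscale (tot B b ` C (k - 1)) ` {x \<in> C k. tot B b x = 0})"
proof -
  interpret Up: Vector_Spaces.linear sscale sscale "Up (k + 1)" by (rule slin_Up)
  interpret Down: Vector_Spaces.linear sscale sscale "Down (k + 1)" by (rule slin_Down)
  note sub = subspace_slin[OF slin_tot[OF flin_d flin_\<iota>]] subspace_slin[OF slin_tot[OF flin_B flin_b]]
  show ?thesis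
  proof (rule seqs.isomorphic_quotients[OF sub(1,3,2,4) slin_Up[of k] slin_Down[of k]])
    show "Up k x \<in> {x \<in> C k. tot B b x = 0}" if "x \<in> {x \<in> C k. tot d \<iota> x = 0}" for x
      using that Up_tot[of x k, symmetric] by (auto simp: Up_C Up.zero)
    show "Down k x \<in> {x \<in> C k. tot d \<iota> x = 0}" if "x \<in> {x \<in> C k. tot B b x = 0}" for x
      using that Down_tot[of x k, symmetric] by (auto simp: Down_C Down.zero)
    show "Up k x \<in> tot B b ` C (k - 1)" if "x \<in> tot d \<iota> ` C (k - 1)" for x
      using that Up_tot[of _ "k - 1"] Up_C[of _ "k - 1"] by auto
    show "Down k x \<in> tot d \<iota> ` C (k - 1)" if "x \<in> tot B b ` C (k - 1)" for x
      using that Down_tot[of _ "k - 1"] Down_C[of _ "k - 1"] by auto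
  qed (auto intro: Down_Up_cycle Up_Down_cycle)
qed

end

context unital_algebra
begin

section \<open>One-forms\<close>

lemma subspace_tensor_rel: "free.subspace tensor_rel"
  by (simp add: tensor_rel_def)

lemma tensor_rel_into:
  assumes "flin f" "free.subspace W"
    and "\<And>a b c. f (gen (a + b, c)) - f (gen (a, c)) - f (gen (b, c)) \<in> W"
    and "\<And>a b c. f (gen (a, b + c)) - f (gen (a, b)) - f (gen (a, c)) \<in> W"
    and "\<And>r a b. f (gen (r *s a, b)) - fscale r (f (gen (a, b))) \<in> W"
    and "\<And>r a b. f (gen (a, r *s b)) - fscale r (f (gen (a, b))) \<in> W"
    and "x \<in> tensor_rel"
  shows "f x \<in> W"
  by (rule span_into[OF assms(1,2) assms(7)[unfolded tensor_rel_def]])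
    (auto simp: flin_diff[OF assms(1)] flin_scale[OF assms(1)] assms(3-6))

lemma quot_tensor_rel: "x \<in> tensor_rel \<Longrightarrow> quot fscale tensor_rel x = 0"
  by (rule free.quot_zero[OF subspace_tensor_rel])

lemmas flin_quot_tensor = flin_quot[OF subspace_tensor_rel]

lemma
  shows tens_add_left: "tens (a + b) c = tens a c + tens b c"
    and tens_add_right: "tens c (a + b) = tens c a + tens c b"
    and tens_scale_left: "tens (r *s a) b = fscale r (tens a b)"
    and tens_scale_right: "tens a (r *s b) = fscale r (tens a b)"
proof -
  note q = flin_add[OF flin_quot_tensor] flin_diff[OF flin_quot_tensor] flin_scale[OF flin_quot_tensor]
  have "gen (a + b, c) - gen (a, c) - gen (b, c) \<in> tensor_rel"
    unfolding tensor_rel_def by (rule free.span_base) blast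
  from quot_tensor_rel[OF this] show "tens (a + b) c = tens a c + tens b c"
    by (simp add: tens_def q algebra_simps)
  have "gen (c, a + b) - gen (c, a) - gen (c, b) \<in> tensor_rel"
    unfolding tensor_rel_def by (rule free.span_base) blast
  from quot_tensor_rel[OF this] show "tens c (a + b) = tens c a + tens c b"
    by (simp add: tens_def q algebra_simps)
  have "gen (r *s a, b) - fscale r (gen (a, b)) \<in> tensor_rel"
    unfolding tensor_rel_def by (rule free.span_base) blast
  from quot_tensor_rel[OF this] show "tens (r *s a) b = fscale r (tens a b)"
    by (simp add: tens_def q)
  have "gen (a, r *s b) - fscale r (gen (a, b)) \<in> tensor_rel"
    unfolding tensor_rel_def by (rule free.span_base) blast
  from quot_tensor_rel[OF this] show "tens a (r *s b) = fscale r (tens a b)"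
    by (simp add: tens_def q)
qed

lemma tensor_square_induct [consumes 1, case_names tens add scale]:
  assumes "m \<in> tensor_square"
    and tens: "\<And>x y. P (tens x y)"
    and add: "\<And>p q. p \<in> tensor_square \<Longrightarrow> q \<in> tensor_square \<Longrightarrow> P p \<Longrightarrow> P q \<Longrightarrow> P (p + q)"
    and scale: "\<And>c p. p \<in> tensor_square \<Longrightarrow> P p \<Longrightarrow> P (fscale c p)"
  shows "P m"
proof -
  have in_ts: "quot fscale tensor_rel p \<in> tensor_square" for p
    by (simp add: tensor_square_def)
  have tens_in: "tens x y \<in> tensor_square" for x y
    by (simp add: tens_def in_ts)
  obtain p where p: "m = quot fscale tensor_rel p"
    using assms(1) by (auto simp: tensor_square_def)
  have "P (quot fscale tensor_rel p)"
    using span_gen[of p]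
  proof (induction p rule: free.span_induct_alt)
    case base
    show ?case using scale[OF tens_in tens, of 0 0 0] by (simp add: flin_zero[OF flin_quot_tensor])
  next
    case (step c x y)
    then obtain u v where "x = gen (u, v)" by auto
    then have "quot fscale tensor_rel (fscale c x + y)
        = fscale c (tens u v) + quot fscale tensor_rel y"
      by (simp add: tens_def flin_add[OF flin_quot_tensor] flin_scale[OF flin_quot_tensor])
    moreover have "fscale c (tens u v) \<in> tensor_square"
      unfolding tens_def flin_scale[OF flin_quot_tensor, symmetric] by (rule in_ts)
    ultimately show ?case using add[OF _ in_ts scale[OF tens_in tens] step(2)] by simp
  qed
  then show ?thesis by (simp add: p)
qed

lemma subspace_tensor_square: "free.subspace tensor_square"
  unfolding tensor_square_def by (rule subspace_flin_image[OF flin_quot_tensor]) simp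

lemma tens_in_square [simp]: "tens x y \<in> tensor_square"
  by (simp add: tens_def tensor_square_def)

lemmas tensor_square_add = free.subspace_add[OF subspace_tensor_square]
  and tensor_square_scale = free.subspace_scale[OF subspace_tensor_square]

lemma flin_lact: "flin (lact a)"
  unfolding lact_def by (rule flin_lin_ext)

lemma flin_ract: "flin (\<lambda>m. ract m a)"
  unfolding ract_def by (rule flin_lin_ext)

lemma lact_tens [simp]: "lact a (tens x y) = tens (a * x) y"
proof -
  have "lact a p = 0" if "p \<in> tensor_rel" for p
    using tensor_rel_into[OF flin_lact free.subspace_single_0 _ _ _ _ that]
    by (auto simp: lact_def distrib_left scale_mult_right tens_add_left tens_add_right
        tens_scale_left tens_scale_right)
  from flin_quot_eq[OF subspace_tensor_rel flin_lact this] show ?thesis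
    by (simp add: tens_def[of x y]) (simp add: lact_def)
qed

lemma ract_tens [simp]: "ract (tens x y) a = tens x (y * a)"
proof -
  have "ract p a = 0" if "p \<in> tensor_rel" for p
    using tensor_rel_into[OF flin_ract free.subspace_single_0 _ _ _ _ that]
    by (auto simp: ract_def distrib_right scale_mult_left tens_add_left tens_add_right
        tens_scale_left tens_scale_right)
  from flin_quot_eq[OF subspace_tensor_rel flin_ract this] show ?thesis
    by (simp add: tens_def[of x y]) (simp add: ract_def)
qed

lemma mult_map_add: "mult_map (p + q) = mult_map p + mult_map q"
  and mult_map_scale: "mult_map (fscale c p) = c *s mult_map p"
  and mult_map_diff: "mult_map (p - q) = mult_map p - mult_map q"
  and mult_map_zero: "mult_map 0 = 0"
proof -
  interpret m: Vector_Spaces.linear fscale scale mult_map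
    unfolding mult_map_def by (rule linear_lin_ext)
  show "mult_map (p + q) = mult_map p + mult_map q" "mult_map (fscale c p) = c *s mult_map p"
    "mult_map (p - q) = mult_map p - mult_map q" "mult_map 0 = 0"
    by (rule m.add m.scale m.diff m.zero)+
qed

lemma mult_map_tens [simp]: "mult_map (tens x y) = x * y"
proof -
  have "mult_map p = 0" if "p \<in> tensor_rel" for p
    using that unfolding tensor_rel_def
  proof (induction p rule: free.span_induct_alt)
    case base
    then show ?case by (rule mult_map_zero)
  next
    case (step c p q)
    have "mult_map p = 0" using step(1)
      by (auto simp: mult_map_diff mult_map_scale)
        (auto simp: mult_map_def distrib_left distrib_right scale_mult_right scale_mult_left)
    then show ?case using step(2) by (simp add: mult_map_add mult_map_scale)
  qed
  then have "mult_map (quot fscale tensor_rel (gen (x, y)) - gen (x, y)) = 0"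
    using free.quot_diff[OF subspace_tensor_rel] by blast
  then show ?thesis by (simp add: tens_def mult_map_diff) (simp add: mult_map_def)
qed

lemma lact_in_square: "m \<in> tensor_square \<Longrightarrow> lact a m \<in> tensor_square"
  by (induction rule: tensor_square_induct)
    (simp_all add: flin_add[OF flin_lact] flin_scale[OF flin_lact]
      tensor_square_add tensor_square_scale)

lemma ract_in_square: "m \<in> tensor_square \<Longrightarrow> ract m a \<in> tensor_square"
  by (induction rule: tensor_square_induct)
    (simp_all add: flin_add[OF flin_ract] flin_scale[OF flin_ract]
      tensor_square_add tensor_square_scale)

lemma mult_map_lact: "m \<in> tensor_square \<Longrightarrow> mult_map (lact a m) = a * mult_map m"
  by (induction rule: tensor_square_induct)
    (simp_all add: flin_add[OF flin_lact] flin_scale[OF flin_lact] mult_map_add mult_map_scale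
      distrib_left scale_mult_right mult.assoc)

lemma mult_map_ract: "m \<in> tensor_square \<Longrightarrow> mult_map (ract m a) = mult_map m * a"
  by (induction rule: tensor_square_induct)
    (simp_all add: flin_add[OF flin_ract] flin_scale[OF flin_ract] mult_map_add mult_map_scale
      distrib_right scale_mult_left mult.assoc)

lemma Omega1_square: "m \<in> Omega1 \<Longrightarrow> m \<in> tensor_square"
  by (simp add: Omega1_def)

lemma lact_Omega1 [simp]: "m \<in> Omega1 \<Longrightarrow> lact a m \<in> Omega1"
  by (simp add: Omega1_def lact_in_square mult_map_lact)

lemma ract_Omega1 [simp]: "m \<in> Omega1 \<Longrightarrow> ract m a \<in> Omega1"
  by (simp add: Omega1_def ract_in_square mult_map_ract)

lemma subspace_Omega1: "free.subspace Omega1"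
  by (auto intro!: free.subspaceI simp: Omega1_def mult_map_add mult_map_scale mult_map_zero
      tensor_square_add tensor_square_scale free.subspace_0[OF subspace_tensor_square])

lemma Omega1_add [simp]: "x \<in> Omega1 \<Longrightarrow> y \<in> Omega1 \<Longrightarrow> x + y \<in> Omega1"
  and Omega1_scale [simp]: "x \<in> Omega1 \<Longrightarrow> fscale c x \<in> Omega1"
  using subspace_Omega1 by (simp_all add: free.subspace_add free.subspace_scale)

lemma ract_ract: "m \<in> tensor_square \<Longrightarrow> ract (ract m a) b = ract m (a * b)"
  by (induction rule: tensor_square_induct)
    (simp_all add: flin_add[OF flin_ract] flin_scale[OF flin_ract] mult.assoc)

lemma ract_one: "m \<in> tensor_square \<Longrightarrow> ract m 1 = m"
  by (induction rule: tensor_square_induct)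
    (simp_all add: flin_add[OF flin_ract] flin_scale[OF flin_ract])

lemma lact_ract: "m \<in> tensor_square \<Longrightarrow> lact a (ract m b) = ract (lact a m) b"
  by (induction rule: tensor_square_induct)
    (simp_all add: flin_add[OF flin_ract] flin_scale[OF flin_ract]
      flin_add[OF flin_lact] flin_scale[OF flin_lact])

lemma ract_add: "m \<in> tensor_square \<Longrightarrow> ract m (a + b) = ract m a + ract m b"
  by (induction rule: tensor_square_induct)
    (simp_all add: flin_add[OF flin_ract] flin_scale[OF flin_ract] distrib_left tens_add_right
      free.scale_right_distrib)

lemma ract_scale: "m \<in> tensor_square \<Longrightarrow> ract m (r *s a) = fscale r (ract m a)"
  by (induction rule: tensor_square_induct)
    (simp_all add: flin_add[OF flin_ract] flin_scale[OF flin_ract] scale_mult_right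
      tens_scale_right free.scale_right_distrib mult.commute)

lemma d1_Omega1 [simp]: "d1 a \<in> Omega1"
  by (simp add: d1_def Omega1_def mult_map_diff free.subspace_diff[OF subspace_tensor_square])

lemma d1_add: "d1 (a + b) = d1 a + d1 b"
  by (simp add: d1_def tens_add_left tens_add_right)

lemma d1_scale: "d1 (r *s a) = fscale r (d1 a)"
  by (simp add: d1_def tens_scale_left tens_scale_right free.scale_right_diff_distrib)

lemma d1_one: "d1 1 = 0"
  by (simp add: d1_def)

lemma d1_mult: "d1 (a * b) = ract (d1 a) b + lact a (d1 b)"
  by (simp add: d1_def flin_diff[OF flin_lact] flin_diff[OF flin_ract])

text \<open>Since x \<otimes> y - xy \<otimes> 1 = x dy, subtracting
  \<open>tens (mult_map m) 1\<close> takes any tensor m into the span; on one-forms the subtracted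
  term vanishes.\<close>

lemma Omega1_span: "m \<in> Omega1 \<Longrightarrow> m \<in> free.span {lact x (d1 y) | x y. True}"
proof -
  let ?S = "free.span {lact x (d1 y) | x y. True}"
  have "m - tens (mult_map m) 1 \<in> ?S" if "m \<in> tensor_square" for m
    using that
  proof (induction rule: tensor_square_induct)
    case (tens x y)
    have "tens x y - tens (x * y) 1 = lact x (d1 y)"
      by (simp add: d1_def flin_diff[OF flin_lact])
    moreover have "lact x (d1 y) \<in> ?S" by (rule free.span_base) blast
    ultimately show ?case by simp
  next
    case (add p q)
    have "p + q - tens (mult_map (p + q)) 1 = (p - tens (mult_map p) 1) + (q - tens (mult_map q) 1)"
      by (simp add: mult_map_add tens_add_left)
    then show ?case using free.span_add[OF add(3,4)] by (simp only:)
  next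
    case (scale c p)
    have "fscale c p - tens (mult_map (fscale c p)) 1 = fscale c (p - tens (mult_map p) 1)"
      by (simp add: mult_map_scale tens_scale_left free.scale_right_diff_distrib)
    then show ?case using free.span_scale[OF scale(2)] by (simp only:)
  qed
  moreover have "tens 0 1 = 0" using tens_scale_left[of 0 0 1] by simp
  ultimately show "m \<in> Omega1 \<Longrightarrow> m \<in> ?S" by (fastforce simp: Omega1_def)
qed

section \<open>The algebra of forms\<close>

lemma subspace_forms_rel: "free.subspace forms_rel"
  by (simp add: forms_rel_def)

lemmas flin_quot_forms = flin_quot[OF subspace_forms_rel]

lemma forms_rel_into:
  assumes "flin f" "free.subspace W"
    and "\<And>a b ms. set ms \<subseteq> Omega1 \<Longrightarrow>
      f (gen (a + b, ms)) - f (gen (a, ms)) - f (gen (b, ms)) \<in> W"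
    and "\<And>r a ms. set ms \<subseteq> Omega1 \<Longrightarrow> f (gen (r *s a, ms)) - fscale r (f (gen (a, ms))) \<in> W"
    and "\<And>a us x y vs. set us \<union> {x, y} \<union> set vs \<subseteq> Omega1 \<Longrightarrow>
      f (gen (a, us @ (x + y) # vs)) - f (gen (a, us @ x # vs)) - f (gen (a, us @ y # vs)) \<in> W"
    and "\<And>r a us x vs. set us \<union> {x} \<union> set vs \<subseteq> Omega1 \<Longrightarrow>
      f (gen (a, us @ fscale r x # vs)) - fscale r (f (gen (a, us @ x # vs))) \<in> W"
    and "\<And>a b x vs. {x} \<union> set vs \<subseteq> Omega1 \<Longrightarrow>
      f (gen (a * b, x # vs)) - f (gen (a, lact b x # vs)) \<in> W"
    and "\<And>a b us x y vs. set us \<union> {x, y} \<union> set vs \<subseteq> Omega1 \<Longrightarrow>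
      f (gen (a, us @ ract x b # y # vs)) - f (gen (a, us @ x # lact b y # vs)) \<in> W"
    and "z \<in> forms_rel"
  shows "f z \<in> W"
  by (rule span_into[OF assms(1,2) assms(9)[unfolded forms_rel_def]])
    (use assms(3-8) in \<open>auto simp: flin_diff[OF assms(1)] flin_scale[OF assms(1)]\<close>)

lemma quot_forms_rel: "x \<in> forms_rel \<Longrightarrow> quot fscale forms_rel x = 0"
  by (rule free.quot_zero[OF subspace_forms_rel])

lemma pure_add_left:
  assumes "set ms \<subseteq> Omega1"
  shows "pure (a + b) ms = pure a ms + pure b ms"
proof -
  have "gen (a + b, ms) - gen (a, ms) - gen (b, ms) \<in> forms_rel"
    unfolding forms_rel_def
    by (rule free.span_base, (rule UnI1)+) (use assms in blast)
  from quot_forms_rel[OF this] show ?thesis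
    by (simp add: pure_def flin_add[OF flin_quot_forms] flin_diff[OF flin_quot_forms] diff_diff_eq)
qed

lemma pure_scale_left:
  assumes "set ms \<subseteq> Omega1"
  shows "pure (r *s a) ms = fscale r (pure a ms)"
proof -
  have "gen (r *s a, ms) - fscale r (gen (a, ms)) \<in> forms_rel"
    unfolding forms_rel_def
    by (rule free.span_base, rule UnI1, rule UnI1, rule UnI1, rule UnI1, rule UnI2) (use assms in blast)
  from quot_forms_rel[OF this] show ?thesis
    by (simp add: pure_def flin_diff[OF flin_quot_forms] flin_scale[OF flin_quot_forms])
qed

lemma pure_add_mid:
  assumes "set us \<union> {x, y} \<union> set vs \<subseteq> Omega1"
  shows "pure a (us @ (x + y) # vs) = pure a (us @ x # vs) + pure a (us @ y # vs)"
proof -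
  have "gen (a, us @ (x + y) # vs) - gen (a, us @ x # vs) - gen (a, us @ y # vs) \<in> forms_rel"
    unfolding forms_rel_def
    by (rule free.span_base, rule UnI1, rule UnI1, rule UnI1, rule UnI2) (use assms in blast)
  from quot_forms_rel[OF this] show ?thesis
    by (simp add: pure_def flin_add[OF flin_quot_forms] flin_diff[OF flin_quot_forms] diff_diff_eq)
qed

lemma pure_scale_mid:
  assumes "set us \<union> {x} \<union> set vs \<subseteq> Omega1"
  shows "pure a (us @ fscale r x # vs) = fscale r (pure a (us @ x # vs))"
proof -
  have "gen (a, us @ fscale r x # vs) - fscale r (gen (a, us @ x # vs)) \<in> forms_rel"
    unfolding forms_rel_def
    by (rule free.span_base, rule UnI1, rule UnI1, rule UnI2) (use assms in blast)
  from quot_forms_rel[OF this] show ?thesis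
    by (simp add: pure_def flin_diff[OF flin_quot_forms] flin_scale[OF flin_quot_forms])
qed

lemma pure_lact:
  assumes "{x} \<union> set vs \<subseteq> Omega1"
  shows "pure (a * b) (x # vs) = pure a (lact b x # vs)"
proof -
  have "gen (a * b, x # vs) - gen (a, lact b x # vs) \<in> forms_rel"
    unfolding forms_rel_def
    by (rule free.span_base, rule UnI1, rule UnI2) (use assms in blast)
  from quot_forms_rel[OF this] show ?thesis
    by (simp add: pure_def flin_diff[OF flin_quot_forms])
qed

lemma pure_ract:
  assumes "set us \<union> {x, y} \<union> set vs \<subseteq> Omega1"
  shows "pure a (us @ ract x b # y # vs) = pure a (us @ x # lact b y # vs)"
proof -
  have "gen (a, us @ ract x b # y # vs) - gen (a, us @ x # lact b y # vs) \<in> forms_rel"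
    unfolding forms_rel_def
    by (rule free.span_base, rule UnI2) (use assms in blast)
  from quot_forms_rel[OF this] show ?thesis
    by (simp add: pure_def flin_diff[OF flin_quot_forms])
qed

lemma pure_zero_mid:
  assumes "set us \<union> set vs \<subseteq> Omega1"
  shows "pure a (us @ 0 # vs) = 0"
  using pure_scale_mid[of us 0 vs a 0] assms free.subspace_0[OF subspace_Omega1] by simp

text \<open>The product is only well behaved on words in \<open>Omega1\<close>; their span contains all relations.\<close>

definition gforms :: "('a, 'k) form set" where
  "gforms = free.span {gen (a, ms) | a ms. set ms \<subseteq> Omega1}"

lemma gen_gforms: "set ms \<subseteq> Omega1 \<Longrightarrow> gen (a, ms) \<in> gforms"
  unfolding gforms_def by (rule free.span_base) blast

lemma forms_rel_gforms: "x \<in> forms_rel \<Longrightarrow> x \<in> gforms"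
  by (rule forms_rel_into[OF flin_id])
    (simp_all add: gforms_def free.span_diff free.span_scale gen_gforms[unfolded gforms_def])

lemma pure_gforms:
  assumes "set ms \<subseteq> Omega1"
  shows "pure a ms \<in> gforms"
  using free.span_add[OF forms_rel_gforms[unfolded gforms_def,
        OF free.quot_diff[OF subspace_forms_rel, of "gen (a, ms)"]]
      gen_gforms[OF assms, unfolded gforms_def, of a]]
  by (simp add: pure_def gforms_def)

section \<open>The product on words of one-forms\<close>

lemma flin_wmult_left: "flin (\<lambda>\<alpha>. \<alpha> \<odot> \<beta>)"
  unfolding wmult_def by (rule flin_lin_ext)

lemma flin_wmult_right: "flin (\<lambda>\<beta>. \<alpha> \<odot> \<beta>)"
  unfolding wmult_def by (rule flin_lin_ext_fun) (rule flin_lin_ext)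

lemmas wmult_add_left = flin_add[OF flin_wmult_left]
  and wmult_diff_left = flin_diff[OF flin_wmult_left]
  and wmult_diff_right = flin_diff[OF flin_wmult_right]
  and wmult_scale_right = flin_scale[OF flin_wmult_right]
  and wmult_zero_left = flin_zero[OF flin_wmult_left]
  and wmult_zero_right = flin_zero[OF flin_wmult_right]

lemma wmult_gen: "gen u \<odot> gen v = pure_mult u v"
  by (simp add: wmult_def)

text \<open>The product alters only the last letter of the left word, or its coefficient if the word
  is empty. Relations away from that letter carry over, and those at it survive because
  \<open>ract\<close> is linear and commutes with \<open>lact\<close>. The product takes values in
  normal forms, so the result is 0 and not merely a relation.\<close>

lemma pure_mult_left_rel:
  assumes z: "z \<in> forms_rel" and ns: "set ns \<subseteq> Omega1"
  shows "z \<odot> gen (c, ns) = 0"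
proof -
  have "z \<odot> gen (c, ns) \<in> {0}"
  proof (rule forms_rel_into[OF flin_wmult_left free.subspace_single_0 _ _ _ _ _ _ z])
    fix a b and ms :: "('a, 'k) tensor2 list" assume "set ms \<subseteq> Omega1"
    then show "gen (a + b, ms) \<odot> gen (c, ns) - gen (a, ms) \<odot> gen (c, ns)
        - gen (b, ms) \<odot> gen (c, ns) \<in> {0}"
      using ns by (cases ms rule: rev_cases) (auto simp: wmult_gen pure_add_left distrib_right)
  next
    fix r a and ms :: "('a, 'k) tensor2 list" assume "set ms \<subseteq> Omega1"
    then show "gen (r *s a, ms) \<odot> gen (c, ns) - fscale r (gen (a, ms) \<odot> gen (c, ns)) \<in> {0}"
      using ns by (cases ms rule: rev_cases) (auto simp: wmult_gen pure_scale_left scale_mult_left)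
  next
    fix a x y and us vs :: "('a, 'k) tensor2 list" assume "set us \<union> {x, y} \<union> set vs \<subseteq> Omega1"
    then show "gen (a, us @ (x + y) # vs) \<odot> gen (c, ns) - gen (a, us @ x # vs) \<odot> gen (c, ns)
        - gen (a, us @ y # vs) \<odot> gen (c, ns) \<in> {0}"
      using ns by (cases vs rule: rev_cases)
        (auto simp: wmult_gen butlast_append flin_add[OF flin_ract] pure_add_mid)
  next
    fix r a x and us vs :: "('a, 'k) tensor2 list" assume "set us \<union> {x} \<union> set vs \<subseteq> Omega1"
    then show "gen (a, us @ fscale r x # vs) \<odot> gen (c, ns)
        - fscale r (gen (a, us @ x # vs) \<odot> gen (c, ns)) \<in> {0}"
      using ns by (cases vs rule: rev_cases)
        (auto simp: wmult_gen butlast_append flin_scale[OF flin_ract] pure_scale_mid)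
  next
    fix a b x and vs :: "('a, 'k) tensor2 list" assume "{x} \<union> set vs \<subseteq> Omega1"
    then show "gen (a * b, x # vs) \<odot> gen (c, ns) - gen (a, lact b x # vs) \<odot> gen (c, ns) \<in> {0}"
      using ns by (cases vs rule: rev_cases)
        (auto simp: wmult_gen butlast_append pure_lact lact_ract Omega1_square)
  next
    fix a b x y and us vs :: "('a, 'k) tensor2 list" assume "set us \<union> {x, y} \<union> set vs \<subseteq> Omega1"
    then show "gen (a, us @ ract x b # y # vs) \<odot> gen (c, ns)
        - gen (a, us @ x # lact b y # vs) \<odot> gen (c, ns) \<in> {0}"
      using ns by (cases vs rule: rev_cases)
        (auto simp: wmult_gen butlast_append pure_ract lact_ract Omega1_square)
  qed
  then show ?thesis by simp
qed

text \<open>The coefficient of the right word is absorbed by the last letter on the left if there is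
  one, and by the left coefficient otherwise. In the first case linearity in the coefficient becomes
  linearity at that letter, and moving b from the coefficient into x becomes balancedness between
  adjacent letters.\<close>

lemma pure_mult_right_rel:
  assumes z: "z \<in> forms_rel" and ps: "set ps \<subseteq> Omega1"
  shows "gen (c, ps) \<odot> z = 0"
proof -
  have "gen (c, ps) \<odot> z \<in> {0}"
  proof (rule forms_rel_into[OF flin_wmult_right free.subspace_single_0 _ _ _ _ _ _ z])
    fix a b and ms :: "('a, 'k) tensor2 list" assume "set ms \<subseteq> Omega1"
    then show "gen (c, ps) \<odot> gen (a + b, ms) - gen (c, ps) \<odot> gen (a, ms)
        - gen (c, ps) \<odot> gen (b, ms) \<in> {0}"
      using ps by (cases ps rule: rev_cases)
        (auto simp: wmult_gen pure_add_left distrib_left ract_add Omega1_square pure_add_mid)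
  next
    fix r a and ms :: "('a, 'k) tensor2 list" assume "set ms \<subseteq> Omega1"
    then show "gen (c, ps) \<odot> gen (r *s a, ms) - fscale r (gen (c, ps) \<odot> gen (a, ms)) \<in> {0}"
      using ps by (cases ps rule: rev_cases)
        (auto simp: wmult_gen pure_scale_left scale_mult_right ract_scale Omega1_square
          pure_scale_mid)
  next
    fix a x y and us vs :: "('a, 'k) tensor2 list"
    assume *: "set us \<union> {x, y} \<union> set vs \<subseteq> Omega1"
    show "gen (c, ps) \<odot> gen (a, us @ (x + y) # vs) - gen (c, ps) \<odot> gen (a, us @ x # vs)
        - gen (c, ps) \<odot> gen (a, us @ y # vs) \<in> {0}"
    proof (cases ps rule: rev_cases)
      case (snoc ps' p)
      then show ?thesis using * ps pure_add_mid[of "ps' @ ract p a # us" x y vs c]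
        by (auto simp: wmult_gen)
    qed (use * in \<open>auto simp: wmult_gen pure_add_mid\<close>)
  next
    fix r a x and us vs :: "('a, 'k) tensor2 list"
    assume *: "set us \<union> {x} \<union> set vs \<subseteq> Omega1"
    show "gen (c, ps) \<odot> gen (a, us @ fscale r x # vs)
        - fscale r (gen (c, ps) \<odot> gen (a, us @ x # vs)) \<in> {0}"
    proof (cases ps rule: rev_cases)
      case (snoc ps' p)
      then show ?thesis using * ps pure_scale_mid[of "ps' @ ract p a # us" x vs c r]
        by (auto simp: wmult_gen)
    qed (use * in \<open>auto simp: wmult_gen pure_scale_mid\<close>)
  next
    fix a b x and vs :: "('a, 'k) tensor2 list"
    assume *: "{x} \<union> set vs \<subseteq> Omega1"
    show "gen (c, ps) \<odot> gen (a * b, x # vs) - gen (c, ps) \<odot> gen (a, lact b x # vs) \<in> {0}"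
    proof (cases ps rule: rev_cases)
      case Nil
      then show ?thesis using * pure_lact[of x vs "c * a" b] by (auto simp: wmult_gen mult.assoc)
    next
      case (snoc ps' p)
      then show ?thesis using * ps pure_ract[of ps' "ract p a" x vs c b]
        by (auto simp: wmult_gen ract_ract Omega1_square)
    qed
  next
    fix a b x y and us vs :: "('a, 'k) tensor2 list"
    assume *: "set us \<union> {x, y} \<union> set vs \<subseteq> Omega1"
    show "gen (c, ps) \<odot> gen (a, us @ ract x b # y # vs)
        - gen (c, ps) \<odot> gen (a, us @ x # lact b y # vs) \<in> {0}"
    proof (cases ps rule: rev_cases)
      case (snoc ps' p)
      then show ?thesis using * ps pure_ract[of "ps' @ ract p a # us" x y vs c b]
        by (auto simp: wmult_gen)
    qed (use * in \<open>auto simp: wmult_gen pure_ract\<close>)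
  qed
  then show ?thesis by simp
qed

lemma pure_wmult_pure:
  assumes "set ms \<subseteq> Omega1" "set ns \<subseteq> Omega1"
  shows "pure a ms \<odot> pure b ns = pure_mult (a, ms) (b, ns)"
proof -
  have "z \<odot> \<beta> = 0" if "z \<in> forms_rel" "\<beta> \<in> gforms" for z \<beta>
    using span_into[OF flin_wmult_right free.subspace_single_0 that(2)[unfolded gforms_def]]
      pure_mult_left_rel[OF that(1)] by blast
  \<comment> \<open>The factors are freed of their normal forms one at a time. While the left one is
    treated, the right one is still \<open>pure b ns\<close>, of which membership in
    \<open>gforms\<close> is what is known.\<close>
  from this[OF free.quot_diff[OF subspace_forms_rel, of "gen (a, ms)"] pure_gforms[OF assms(2)]]
  have "pure a ms \<odot> pure b ns = gen (a, ms) \<odot> pure b ns"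
    by (simp add: pure_def[of a ms] wmult_diff_left)
  also have "\<dots> = gen (a, ms) \<odot> gen (b, ns)"
    using pure_mult_right_rel[OF free.quot_diff[OF subspace_forms_rel, of "gen (b, ns)"] assms(1)]
    by (simp add: pure_def[of b ns] wmult_diff_right)
  finally show ?thesis by (simp only: wmult_gen)
qed

lemma pure_mult_Nil:
  assumes "set ns \<subseteq> Omega1"
  shows "pure a [] \<odot> pure b ns = pure (a * b) ns"
  using pure_wmult_pure[of "[]" ns a b] assms by simp

lemma pure_mult_snoc:
  assumes "set ms \<subseteq> Omega1" "m \<in> Omega1" "set ns \<subseteq> Omega1"
  shows "pure a (ms @ [m]) \<odot> pure b ns = pure a (ms @ ract m b # ns)"
  using pure_wmult_pure[of "ms @ [m]" ns a b] assms by simp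

section \<open>Grading and associativity\<close>

lemma Omega_eq: "Omega = free.span {pure a ms | a ms. set ms \<subseteq> Omega1}"
proof
  have "Omega_deg n \<subseteq> free.span {pure a ms | a ms. set ms \<subseteq> Omega1}" for n
    unfolding Omega_deg_def by (rule free.span_mono) blast
  then show "Omega \<subseteq> free.span {pure a ms | a ms. set ms \<subseteq> Omega1}"
    unfolding Omega_def by (intro free.span_minimal) auto
  have "pure a ms \<in> Omega_deg (length ms)" if "set ms \<subseteq> Omega1" for a ms
    unfolding Omega_deg_def using that by (intro free.span_base) blast
  then show "free.span {pure a ms | a ms. set ms \<subseteq> Omega1} \<subseteq> Omega"
    unfolding Omega_def by (intro free.span_mono) blast
qed

lemma subspace_Omega_deg: "free.subspace (Omega_deg n)"
  by (simp add: Omega_deg_def)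

lemma subspace_Omega: "free.subspace Omega"
  by (simp add: Omega_def)

lemma Omega_deg_Omega: "\<alpha> \<in> Omega_deg n \<Longrightarrow> \<alpha> \<in> Omega"
  unfolding Omega_def by (rule free.span_base) blast

lemma pure_Omega_deg: "set ms \<subseteq> Omega1 \<Longrightarrow> length ms = n \<Longrightarrow> pure a ms \<in> Omega_deg n"
  unfolding Omega_deg_def by (rule free.span_base) blast

lemma Omega_deg_into:
  assumes "\<alpha> \<in> Omega_deg n" "flin f" "free.subspace W"
    "\<And>a ms. set ms \<subseteq> Omega1 \<Longrightarrow> length ms = n \<Longrightarrow> f (pure a ms) \<in> W"
  shows "f \<alpha> \<in> W"
  by (rule span_into[OF assms(2,3) assms(1)[unfolded Omega_deg_def]]) (use assms(4) in blast)

lemma Omega_pure_eq: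
  assumes "\<alpha> \<in> Omega" "flin f" "flin g"
    "\<And>a ms. set ms \<subseteq> Omega1 \<Longrightarrow> f (pure a ms) = g (pure a ms)"
  shows "f \<alpha> = g \<alpha>"
  by (rule span_eq_on[OF assms(2,3) assms(1)[unfolded Omega_eq]]) (use assms(4) in blast)

lemma wmult_deg:
  assumes "\<alpha> \<in> Omega_deg p" "\<beta> \<in> Omega_deg q"
  shows "\<alpha> \<odot> \<beta> \<in> Omega_deg (p + q)"
proof (rule Omega_deg_into[OF assms(1) flin_wmult_left subspace_Omega_deg])
  fix a and ms :: "('a, 'k) tensor2 list" assume ms: "set ms \<subseteq> Omega1" "length ms = p"
  show "pure a ms \<odot> \<beta> \<in> Omega_deg (p + q)"
  proof (rule Omega_deg_into[OF assms(2) flin_wmult_right subspace_Omega_deg])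
    fix b and ns :: "('a, 'k) tensor2 list" assume ns: "set ns \<subseteq> Omega1" "length ns = q"
    show "pure a ms \<odot> pure b ns \<in> Omega_deg (p + q)"
      using ms ns by (cases ms rule: rev_cases)
        (auto simp: pure_mult_Nil pure_mult_snoc intro!: pure_Omega_deg)
  qed
qed

lemma wmult_Omega:
  assumes "\<alpha> \<in> Omega" "\<beta> \<in> Omega"
  shows "\<alpha> \<odot> \<beta> \<in> Omega"
proof (rule span_into[OF flin_wmult_left subspace_Omega assms(1)[unfolded Omega_def]])
  fix \<alpha>' assume *: "\<alpha>' \<in> (\<Union>n. Omega_deg n)"
  show "\<alpha>' \<odot> \<beta> \<in> Omega"
    by (rule span_into[OF flin_wmult_right subspace_Omega assms(2)[unfolded Omega_def]])
      (use * in \<open>blast intro: Omega_deg_Omega wmult_deg\<close>)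
qed

lemma wmult_assoc:
  assumes "\<alpha> \<in> Omega" "\<beta> \<in> Omega" "\<gamma> \<in> Omega"
  shows "\<alpha> \<odot> \<beta> \<odot> \<gamma> = \<alpha> \<odot> (\<beta> \<odot> \<gamma>)"
proof (rule Omega_pure_eq[OF assms(1)])
  fix a and ms :: "('a, 'k) tensor2 list" assume ms: "set ms \<subseteq> Omega1"
  show "pure a ms \<odot> \<beta> \<odot> \<gamma> = pure a ms \<odot> (\<beta> \<odot> \<gamma>)"
  proof (rule Omega_pure_eq[OF assms(2)])
    fix b and ns :: "('a, 'k) tensor2 list" assume ns: "set ns \<subseteq> Omega1"
    show "pure a ms \<odot> pure b ns \<odot> \<gamma> = pure a ms \<odot> (pure b ns \<odot> \<gamma>)"
    proof (rule Omega_pure_eq[OF assms(3)])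
      fix c and ps :: "('a, 'k) tensor2 list" assume ps: "set ps \<subseteq> Omega1"
      note [simp] = pure_mult_Nil pure_mult_snoc
      show "pure a ms \<odot> pure b ns \<odot> pure c ps = pure a ms \<odot> (pure b ns \<odot> pure c ps)"
      proof (cases ms rule: rev_cases; cases ns rule: rev_cases)
        assume "ms = []" "ns = []"
        then show ?thesis using ps by (simp add: mult.assoc)
      next
        fix ns' n assume "ms = []" "ns = ns' @ [n]"
        then show ?thesis using ns ps by simp
      next
        fix ms' m assume "ms = ms' @ [m]" "ns = []"
        then show ?thesis using ms ps by (simp add: ract_ract Omega1_square)
      next
        fix ms' m ns' n assume "ms = ms' @ [m]" "ns = ns' @ [n]"
        then show ?thesis using ms ns ps pure_mult_snoc[of "ms' @ ract m b # ns'" n ps a c]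
          by simp
      qed
    qed (intro flin_wmult_right flin_comp[OF flin_wmult_right flin_wmult_right])+
  qed (intro flin_wmult_left flin_comp[OF flin_wmult_left flin_wmult_right]
      flin_comp[OF flin_wmult_right flin_wmult_left])+
qed (intro flin_wmult_left flin_comp[OF flin_wmult_left flin_wmult_left])+

lemma emb_one_left: "\<alpha> \<in> Omega \<Longrightarrow> emb 1 \<odot> \<alpha> = \<alpha>"
  by (rule Omega_pure_eq[OF _ flin_wmult_right flin_id]) (auto simp: emb_def pure_mult_Nil)

lemma emb_one_right: "\<alpha> \<in> Omega \<Longrightarrow> \<alpha> \<odot> emb 1 = \<alpha>"
proof (rule Omega_pure_eq[OF _ flin_wmult_left flin_id])
  fix a and ms :: "('a, 'k) tensor2 list" assume "set ms \<subseteq> Omega1"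
  then show "pure a ms \<odot> emb 1 = pure a ms"
    by (cases ms rule: rev_cases)
      (auto simp: emb_def pure_mult_Nil pure_mult_snoc ract_one Omega1_square)
qed

lemma emb_deg [simp]: "emb a \<in> Omega_deg 0"
  by (simp add: emb_def pure_Omega_deg)

lemma dd_deg [simp]: "dd a \<in> Omega_deg 1"
  by (simp add: dd_def pure_Omega_deg)

lemma emb_Omega [simp]: "emb a \<in> Omega" and dd_Omega [simp]: "dd a \<in> Omega"
  by (rule Omega_deg_Omega, rule emb_deg) (rule Omega_deg_Omega, rule dd_deg)

lemma emb_add: "emb (a + b) = emb a + emb b"
  by (simp add: emb_def pure_add_left)

lemma emb_scale: "emb (r *s a) = fscale r (emb a)"
  by (simp add: emb_def pure_scale_left)

lemma emb_mult: "emb (a * b) = emb a \<odot> emb b"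
  by (simp add: emb_def pure_mult_Nil)

lemma dd_one: "dd 1 = 0"
  using pure_zero_mid[of "[]" "[]" 1] by (simp add: dd_def d1_one)

lemma dd_mult: "dd (a * b) = dd a \<odot> emb b + emb a \<odot> dd b"
proof -
  have "dd a \<odot> emb b = pure 1 [ract (d1 a) b]"
    using pure_mult_snoc[of "[]" "d1 a" "[]" 1 b] by (simp add: dd_def emb_def)
  moreover have "emb a \<odot> dd b = pure 1 [lact a (d1 b)]"
    using pure_lact[of "d1 b" "[]" 1 a] by (simp add: dd_def emb_def pure_mult_Nil)
  ultimately show ?thesis
    using pure_add_mid[of "[]" "ract (d1 a) b" "lact a (d1 b)" "[]" 1] by (simp add: dd_def d1_mult)
qed

lemma d1_image_Omega1 [simp]: "d1 ` S \<subseteq> Omega1"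
  by auto

lemma dprod_pure: "dprod as = pure 1 (map d1 as)"
proof (induction as)
  case Nil
  then show ?case by (simp add: dprod_def emb_def)
next
  case (Cons x as)
  have "dprod (x # as) = dd x \<odot> pure 1 (map d1 as)" using Cons by (simp add: dprod_def)
  also have "\<dots> = pure 1 (ract (d1 x) 1 # map d1 as)"
    using pure_mult_snoc[of "[]" "d1 x" "map d1 as" 1 1] by (simp add: dd_def)
  finally show ?case by (simp add: ract_one Omega1_square)
qed

lemma nform_pure: "nform a as = pure a (map d1 as)"
  by (simp add: nform_def dprod_pure emb_def pure_mult_Nil)

lemma dprod_deg: "length as = n \<Longrightarrow> dprod as \<in> Omega_deg n"
  by (simp add: dprod_pure pure_Omega_deg)

lemma nform_deg: "length as = n \<Longrightarrow> nform a as \<in> Omega_deg n"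
  by (simp add: nform_pure pure_Omega_deg)

lemma dprod_Omega [simp]: "dprod as \<in> Omega" and nform_Omega [simp]: "nform a as \<in> Omega"
  by (rule Omega_deg_Omega, rule dprod_deg, rule refl)
    (rule Omega_deg_Omega, rule nform_deg, rule refl)

lemma dprod_Nil [simp]: "dprod [] = emb 1"
  by (simp add: dprod_def)

lemma dprod_Cons: "dprod (a # as) = dd a \<odot> dprod as"
  by (simp add: dprod_def)

lemma dprod_append: "dprod (as @ bs) = dprod as \<odot> dprod bs"
  by (induction as) (simp_all add: dprod_Cons wmult_assoc emb_one_left)

lemma dprod_single [simp]: "dprod [a] = dd a"
  by (simp add: dprod_Cons emb_one_right)

lemma nform_Nil [simp]: "nform a [] = emb a"
  by (simp add: nform_def emb_one_right)

lemma nform_one: "nform 1 as = dprod as"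
  by (simp add: nform_def emb_one_left)

lemma nform_snoc: "nform a as \<odot> dd x = nform a (as @ [x])"
  by (simp add: nform_def dprod_append wmult_assoc)

lemma emb_nform: "emb b \<odot> nform a as = nform (b * a) as"
  by (simp add: nform_def wmult_assoc[symmetric] emb_mult)

text \<open>The Leibniz rule in the form dx b = d(xb) - x db removes the coefficient b standing
  behind dx.\<close>

lemma dd_nform: "dd x \<odot> nform b bs = dprod (x * b # bs) - nform x (b # bs)"
proof -
  have "dd x \<odot> emb b = dd (x * b) - emb x \<odot> dd b" by (simp add: dd_mult)
  then show ?thesis
    by (simp add: nform_def dprod_Cons wmult_assoc[symmetric] wmult_Omega wmult_diff_left)
qed

text \<open>The span on the right is closed under left multiplication by A and, one degree up, by
  every dx, thanks to \<open>dd_nform\<close>. Since one-forms are spanned by the x dy, a word is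
  built up from its last letter by such multiplications.\<close>

lemma Omega_deg_eq: "Omega_deg n = free.span {nform a as | a as. length as = n}"
proof
  show "free.span {nform a as | a as. length as = n} \<subseteq> Omega_deg n"
    by (rule free.span_minimal[OF _ subspace_Omega_deg]) (auto intro: nform_deg)
  let ?S = "\<lambda>n. free.span {nform a as | a as. length as = n}"
  have base: "nform a as \<in> ?S (length as)" for a as
    by (rule free.span_base) blast
  have emb_S: "emb b \<odot> \<alpha> \<in> ?S n" if "\<alpha> \<in> ?S n" for b \<alpha> n
    by (rule span_into[OF flin_wmult_right free.subspace_span that])
      (use base in \<open>auto simp: emb_nform\<close>)
  have dd_S: "dd x \<odot> \<alpha> \<in> ?S (Suc n)" if "\<alpha> \<in> ?S n" for x \<alpha> n
  proof (rule span_into[OF flin_wmult_right free.subspace_span that])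
    fix \<alpha> assume "\<alpha> \<in> {nform a as | a as. length as = n}"
    then obtain b bs where "\<alpha> = nform b bs" "length bs = n" by blast
    then show "dd x \<odot> \<alpha> \<in> ?S (Suc n)"
      using base[of 1 "x * b # bs"] base[of x "b # bs"]
      by (simp add: dd_nform nform_one free.span_diff)
  qed
  have "pure a ms \<in> ?S (length ms)" if "set ms \<subseteq> Omega1" for a ms
    using that
  proof (induction ms arbitrary: a)
    case Nil
    then show ?case using base[of a "[]"] by (simp add: emb_def)
  next
    case (Cons m ms)
    have pure1: "pure 1 ms \<in> ?S (length ms)" using Cons by simp
    have "m \<in> free.span {lact x (d1 y) | x y. True}" using Cons(2) by (intro Omega1_span) simp
    \<comment> \<open>Membership in \<open>Omega1\<close> is carried along because additivity of
      \<open>pure\<close> in a letter is available for letters from \<open>Omega1\<close>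
      only.\<close>
    then have "m \<in> Omega1 \<and> pure a (m # ms) \<in> ?S (length (m # ms))"
    proof (induction rule: free.span_induct_alt)
      case base
      then show ?case using pure_zero_mid[of "[]" ms a] Cons(2) free.subspace_0[OF subspace_Omega1]
        by (simp add: free.span_zero)
    next
      case (step c u v)
      then obtain x y where u: "u = lact x (d1 y)" by blast
      have "pure a (u # ms) = pure (a * x) (d1 y # ms)"
        using pure_lact[of "d1 y" ms a x] Cons(2) by (simp add: u)
      also have "\<dots> = emb (a * x) \<odot> (dd y \<odot> pure 1 ms)"
        using pure_mult_snoc[of "[]" "d1 y" ms 1 1] Cons(2)
        by (simp add: dd_def emb_def ract_one Omega1_square pure_mult_Nil)
      finally have "pure a (u # ms) \<in> ?S (length (u # ms))"
        using emb_S[OF dd_S[OF pure1]] by simp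
      then show ?case
        using step(2) Cons(2) pure_add_mid[of "[]" "fscale c u" v ms a]
          pure_scale_mid[of "[]" u ms a c]
        by (simp add: u free.span_add free.span_scale)
    qed
    then show ?case by simp
  qed
  then show "Omega_deg n \<subseteq> ?S n"
    unfolding Omega_deg_def by (intro free.span_minimal) (auto simp: Omega_deg_def)
qed

lemma Omega_deg_nform_into:
  assumes "\<alpha> \<in> Omega_deg n" "flin f" "free.subspace W"
    "\<And>a as. length as = n \<Longrightarrow> f (nform a as) \<in> W"
  shows "f \<alpha> \<in> W"
  by (rule span_into[OF assms(2,3) assms(1)[unfolded Omega_deg_eq]]) (use assms(4) in blast)

lemma Omega_deg_nform_eq:
  assumes "\<alpha> \<in> Omega_deg n" "flin f" "flin g"
    "\<And>a as. length as = n \<Longrightarrow> f (nform a as) = g (nform a as)"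
  shows "f \<alpha> = g \<alpha>"
  by (rule span_eq_on[OF assms(2,3) assms(1)[unfolded Omega_deg_eq]]) (use assms(4) in blast)

lemma Omega_nform_eq:
  assumes "\<alpha> \<in> Omega" "flin f" "flin g" "\<And>a as. f (nform a as) = g (nform a as)"
  shows "f \<alpha> = g \<alpha>"
  by (rule span_eq_on[OF assms(2,3) assms(1)[unfolded Omega_def]])
    (use Omega_deg_nform_eq[OF _ assms(2,3)] assms(4) in blast)

section \<open>The universal property of the forms of degree \<open>n\<close>\<close>

text \<open>The functions that factor through A \<otimes> (A/k) \<otimes> ... \<otimes> (A/k), for
  any number of factors at once: the last clause lets all entries but the first be taken modulo
  scalars.\<close>

definition nmultilin :: "('a \<Rightarrow> 'a list \<Rightarrow> ('x \<Rightarrow>\<^sub>0 'k)) \<Rightarrow> bool" where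
  "nmultilin f \<longleftrightarrow>
     (\<forall>a b as. f (a + b) as = f a as + f b as) \<and>
     (\<forall>r a as. f (r *s a) as = fscale r (f a as)) \<and>
     (\<forall>a us x y vs. f a (us @ (x + y) # vs) = f a (us @ x # vs) + f a (us @ y # vs)) \<and>
     (\<forall>r a us x vs. f a (us @ (r *s x) # vs) = fscale r (f a (us @ x # vs))) \<and>
     (\<forall>a us vs. f a (us @ 1 # vs) = 0)"

lemma nmultilin_nform: "nmultilin nform"
  unfolding nmultilin_def nform_pure
  by (auto simp: pure_add_left pure_scale_left d1_add d1_scale d1_one pure_add_mid pure_scale_mid
      pure_zero_mid)

lemma nmultilin_flin: "nmultilin f \<Longrightarrow> (\<And>n. flin (T n)) \<Longrightarrow> nmultilin (\<lambda>a as. T (length as) (f a as))"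
  unfolding nmultilin_def by (simp add: flin_add flin_scale flin_zero)

text \<open>
  \<open>nrel\<close> is the space of relations of \<open>A \<otimes> (A/k)\<^sup>\<otimes>\<^sup>n\<close> for all \<open>n\<close>.  On the quotient, \<open>nleft a\<close> is left
  multiplication by \<open>a\<close>, \<open>nd\<close> is the differential, and \<open>npsi m\<close> is left multiplication by the one-form \<open>m\<close>:
  if \<open>m\<close> is the sum of \<open>x\<^sub>i \<otimes> y\<^sub>i\<close> with the sum of \<open>x\<^sub>i y\<^sub>i\<close> equal to 0, then \<open>m\<close> times \<open>\<omega>\<close> is the sum of
  \<open>x\<^sub>i d(y\<^sub>i \<omega>)\<close>.
\<close>

definition nrel :: "(('a \<times> 'a list) \<Rightarrow>\<^sub>0 'k) set" where
  "nrel = free.span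
     ({gen (a + b, as) - gen (a, as) - gen (b, as) | a b as. True} \<union>
      {gen (r *s a, as) - fscale r (gen (a, as)) | r a as. True} \<union>
      {gen (a, us @ (x + y) # vs) - gen (a, us @ x # vs) - gen (a, us @ y # vs) | a us x y vs. True} \<union>
      {gen (a, us @ (r *s x) # vs) - fscale r (gen (a, us @ x # vs)) | r a us x vs. True} \<union>
      {gen (a, us @ 1 # vs) | a us vs. True})"

definition nleft :: "'a \<Rightarrow> (('a \<times> 'a list) \<Rightarrow>\<^sub>0 'k) \<Rightarrow> (('a \<times> 'a list) \<Rightarrow>\<^sub>0 'k)" where
  "nleft a = lin_ext fscale (\<lambda>(x, as). gen (a * x, as))"

definition nd :: "(('a \<times> 'a list) \<Rightarrow>\<^sub>0 'k) \<Rightarrow> (('a \<times> 'a list) \<Rightarrow>\<^sub>0 'k)" where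
  "nd = lin_ext fscale (\<lambda>(x, as). gen (1, x # as))"

definition npsi :: "('a, 'k) tensor2 \<Rightarrow> (('a \<times> 'a list) \<Rightarrow>\<^sub>0 'k) \<Rightarrow> (('a \<times> 'a list) \<Rightarrow>\<^sub>0 'k)" where
  "npsi m c = lin_ext fscale (\<lambda>p. nleft (fst p) (nd (nleft (snd p) c))) m"

text \<open>A form acts by left multiplication on the quotient by \<open>nrel\<close>; applied to
  the element 1, this yields its expansion in the symbols \<open>(a, as)\<close>. It undoes the map
  from symbols to forms, which shows that no further relations hold among the a_0 da_1 ...
  da_n.\<close>

definition nPhi :: "('a, 'k) form \<Rightarrow> (('a \<times> 'a list) \<Rightarrow>\<^sub>0 'k)" where
  "nPhi = lin_ext fscale (\<lambda>(a, ms). nleft a (foldr npsi ms (gen (1, []))))"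

lemma subspace_nrel: "free.subspace nrel"
  by (simp add: nrel_def)

lemma nrel_into:
  assumes "flin f" "free.subspace W"
    and "\<And>a b as. f (gen (a + b, as)) - f (gen (a, as)) - f (gen (b, as)) \<in> W"
    and "\<And>r a as. f (gen (r *s a, as)) - fscale r (f (gen (a, as))) \<in> W"
    and "\<And>a us x y vs. f (gen (a, us @ (x + y) # vs)) - f (gen (a, us @ x # vs))
      - f (gen (a, us @ y # vs)) \<in> W"
    and "\<And>r a us x vs. f (gen (a, us @ (r *s x) # vs)) - fscale r (f (gen (a, us @ x # vs))) \<in> W"
    and "\<And>a us vs. f (gen (a, us @ 1 # vs)) \<in> W"
    and "z \<in> nrel"
  shows "f z \<in> W"
  by (rule span_into[OF assms(1,2) assms(8)[unfolded nrel_def]])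
    (use assms(3-7) in \<open>auto simp: flin_diff[OF assms(1)] flin_scale[OF assms(1)]\<close>)

lemma
  shows nrel_add_left: "gen (a + b, as) - gen (a, as) - gen (b, as) \<in> nrel"
    and nrel_scale_left: "gen (r *s a, as) - fscale r (gen (a, as)) \<in> nrel"
    and nrel_add_mid:
      "gen (a, us @ (x + y) # vs) - gen (a, us @ x # vs) - gen (a, us @ y # vs) \<in> nrel"
    and nrel_scale_mid: "gen (a, us @ (r *s x) # vs) - fscale r (gen (a, us @ x # vs)) \<in> nrel"
    and nrel_one_mid: "gen (a, us @ 1 # vs) \<in> nrel"
  unfolding nrel_def
  by (rule free.span_base, (rule UnI1)+, blast)
    (rule free.span_base, rule UnI1, rule UnI1, rule UnI1, rule UnI2, blast,
     rule free.span_base, rule UnI1, rule UnI1, rule UnI2, blast,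
     rule free.span_base, rule UnI1, rule UnI2, blast,
     rule free.span_base, rule UnI2, blast)

lemma nmultilin_nrel:
  assumes "nmultilin f" "z \<in> nrel"
  shows "lin_ext fscale (\<lambda>(a, as). f a as) z = 0"
proof -
  have "lin_ext fscale (\<lambda>(a, as). f a as) z \<in> {0}"
    by (rule nrel_into[OF flin_lin_ext free.subspace_single_0 _ _ _ _ _ assms(2)])
      (use assms(1) in \<open>auto simp: nmultilin_def\<close>)
  then show ?thesis by simp
qed

definition ncong :: "(('a \<times> 'a list) \<Rightarrow>\<^sub>0 'k) \<Rightarrow> (('a \<times> 'a list) \<Rightarrow>\<^sub>0 'k) \<Rightarrow> bool" where
  "ncong x y \<longleftrightarrow> x - y \<in> nrel"

lemma ncong_refl [simp]: "ncong x x"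
  by (simp add: ncong_def free.subspace_0[OF subspace_nrel])

lemma ncong_sym: "ncong x y \<Longrightarrow> ncong y x"
  unfolding ncong_def using free.subspace_neg[OF subspace_nrel] by fastforce

lemma ncong_trans [trans]: "ncong x y \<Longrightarrow> ncong y z \<Longrightarrow> ncong x z"
  unfolding ncong_def using free.subspace_add[OF subspace_nrel, of "x - y" "y - z"] by simp

lemma ncong_diff: "ncong x y \<Longrightarrow> ncong x' y' \<Longrightarrow> ncong (x - x') (y - y')"
  unfolding ncong_def using free.subspace_diff[OF subspace_nrel, of "x - y" "x' - y'"]
  by (simp add: algebra_simps)

lemma ncong_zero: "ncong x 0 \<longleftrightarrow> x \<in> nrel"
  by (simp add: ncong_def)

lemma ncong_flin:
  assumes "flin f" "\<And>z. z \<in> nrel \<Longrightarrow> f z \<in> nrel" "ncong x y"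
  shows "ncong (f x) (f y)"
  using assms by (simp add: ncong_def flin_diff[symmetric])

lemma ncong_gens:
  assumes "flin f" "flin g" "\<And>x. ncong (f (gen x)) (g (gen x))"
  shows "ncong (f p) (g p)"
  unfolding ncong_def
  by (rule gens_into[OF flin_minus[OF assms(1,2)] subspace_nrel])
    (use assms(3) in \<open>simp add: ncong_def\<close>)

lemma flin_nleft: "flin (nleft a)" and flin_nd: "flin nd" and flin_nPhi: "flin nPhi"
  unfolding nleft_def nd_def nPhi_def by (rule flin_lin_ext)+

lemma flin_npsi_left: "flin (\<lambda>m. npsi m c)"
  unfolding npsi_def by (rule flin_lin_ext)

lemma flin_npsi: "flin (npsi m)"
  unfolding npsi_def
  by (rule flin_lin_ext_fun) (intro flin_comp[OF flin_nleft flin_comp[OF flin_nd flin_nleft]])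

lemma flin_foldr_npsi: "flin (foldr npsi ms)"
proof (induction ms)
  case Nil
  then show ?case using flin_id by (simp add: id_def)
next
  case (Cons m ms)
  then show ?case using flin_comp[OF flin_npsi] by (simp add: o_def)
qed

lemma nleft_gen [simp]: "nleft a (gen (x, as)) = gen (a * x, as)"
  and nd_gen [simp]: "nd (gen (x, as)) = gen (1, x # as)"
  and npsi_gen: "npsi (gen (x, y)) c = nleft x (nd (nleft y c))"
  and nPhi_gen: "nPhi (gen (a, ms)) = nleft a (foldr npsi ms (gen (1, [])))"
  by (simp_all add: nleft_def nd_def npsi_def nPhi_def)

lemma nleft_nrel: "z \<in> nrel \<Longrightarrow> nleft a z \<in> nrel"
  by (rule nrel_into[OF flin_nleft subspace_nrel])
    (simp_all add: distrib_left scale_mult_right nrel_add_left nrel_scale_left nrel_add_mid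
      nrel_scale_mid nrel_one_mid)

lemma nd_nrel: "z \<in> nrel \<Longrightarrow> nd z \<in> nrel"
proof (rule nrel_into[OF flin_nd subspace_nrel])
  fix a b r x y and as us vs :: "'a list"
  show "nd (gen (a + b, as)) - nd (gen (a, as)) - nd (gen (b, as)) \<in> nrel"
    using nrel_add_mid[of 1 "[]" a b as] by simp
  show "nd (gen (r *s a, as)) - fscale r (nd (gen (a, as))) \<in> nrel"
    using nrel_scale_mid[of 1 "[]" r a as] by simp
  show "nd (gen (a, us @ (x + y) # vs)) - nd (gen (a, us @ x # vs)) - nd (gen (a, us @ y # vs)) \<in> nrel"
    using nrel_add_mid[of 1 "a # us" x y vs] by simp
  show "nd (gen (a, us @ (r *s x) # vs)) - fscale r (nd (gen (a, us @ x # vs))) \<in> nrel"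
    using nrel_scale_mid[of 1 "a # us" r x vs] by simp
  show "nd (gen (a, us @ 1 # vs)) \<in> nrel"
    using nrel_one_mid[of 1 "a # us" vs] by simp
qed

lemma npsi_nrel: "z \<in> nrel \<Longrightarrow> npsi m z \<in> nrel"
  by (rule gens_into[OF flin_npsi_left subspace_nrel])
    (auto simp: npsi_gen nleft_nrel nd_nrel)

lemma foldr_npsi_nrel: "z \<in> nrel \<Longrightarrow> foldr npsi ms z \<in> nrel"
  by (induction ms) (auto simp: npsi_nrel)

lemma
  assumes "ncong x y"
  shows ncong_nleft: "ncong (nleft a x) (nleft a y)"
    and ncong_nd: "ncong (nd x) (nd y)"
    and ncong_npsi: "ncong (npsi m x) (npsi m y)"
    and ncong_foldr_npsi: "ncong (foldr npsi ms x) (foldr npsi ms y)"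
  by (rule ncong_flin[OF _ _ assms], rule flin_nleft flin_nd flin_npsi flin_foldr_npsi,
      erule nleft_nrel nd_nrel npsi_nrel foldr_npsi_nrel)+

lemma nleft_mult: "nleft (a * b) c = nleft a (nleft b c)"
  by (rule gens_eq[OF flin_nleft flin_comp[OF flin_nleft flin_nleft]])
    (auto simp: mult.assoc)

lemma nleft_add: "ncong (nleft (a + b) c) (nleft a c + nleft b c)"
  by (rule ncong_gens[OF flin_nleft flin_plus[OF flin_nleft flin_nleft]])
    (auto simp: ncong_def distrib_right diff_diff_eq[symmetric] nrel_add_left)

lemma nleft_scale: "ncong (nleft (r *s a) c) (fscale r (nleft a c))"
  by (rule ncong_gens[OF flin_nleft flin_fscale[OF flin_nleft]])
    (auto simp: ncong_def scale_mult_left nrel_scale_left)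

lemma npsi_tensor_rel:
  assumes "m \<in> tensor_rel"
  shows "npsi m c \<in> nrel"
proof (rule tensor_rel_into[OF flin_npsi_left subspace_nrel _ _ _ _ assms])
  fix a b e r
  show "npsi (gen (a + b, e)) c - npsi (gen (a, e)) c - npsi (gen (b, e)) c \<in> nrel"
    using nleft_add by (simp add: npsi_gen ncong_def diff_diff_eq)
  show "npsi (gen (r *s a, b)) c - fscale r (npsi (gen (a, b)) c) \<in> nrel"
    using nleft_scale by (simp add: npsi_gen ncong_def)
  show "npsi (gen (a, b + e)) c - npsi (gen (a, b)) c - npsi (gen (a, e)) c \<in> nrel"
    using ncong_nleft[OF ncong_nd[OF nleft_add]]
    by (simp add: npsi_gen ncong_def diff_diff_eq flin_add[OF flin_nd] flin_add[OF flin_nleft])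
  show "npsi (gen (a, r *s b)) c - fscale r (npsi (gen (a, b)) c) \<in> nrel"
    using ncong_nleft[OF ncong_nd[OF nleft_scale]]
    by (simp add: npsi_gen ncong_def flin_scale[OF flin_nd] flin_scale[OF flin_nleft])
qed

lemma npsi_tens: "ncong (npsi (tens x y) c) (nleft x (nd (nleft y c)))"
  unfolding ncong_def tens_def npsi_gen[symmetric]
  by (rule flin_quot_diff[OF subspace_tensor_rel flin_npsi_left npsi_tensor_rel])

lemma npsi_lact: "ncong (npsi (lact b m) c) (nleft b (npsi m c))"
proof (rule ncong_gens[OF flin_comp[OF flin_npsi_left flin_lact] flin_comp[OF flin_nleft flin_npsi_left]])
  fix p :: "'a \<times> 'a"
  obtain x y where p: "p = (x, y)" by (cases p)
  have "lact b (gen p) = tens (b * x) y" by (simp add: p lact_def)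
  then show "ncong (npsi (lact b (gen p)) c) (nleft b (npsi (gen p) c))"
    using npsi_tens[of "b * x" y c] by (simp add: p npsi_gen nleft_mult)
qed

text \<open>The factor b joins the second tensor factor y and acts on c before y does. Together with
  \<open>npsi_lact\<close> this makes \<open>nPhi\<close> respect balancedness.\<close>

lemma npsi_ract: "ncong (npsi (ract m b) c) (npsi m (nleft b c))"
proof (rule ncong_gens[OF flin_comp[OF flin_npsi_left flin_ract] flin_npsi_left])
  fix p :: "'a \<times> 'a"
  obtain x y where p: "p = (x, y)" by (cases p)
  have "ract (gen p) b = tens x (y * b)" by (simp add: p ract_def)
  then show "ncong (npsi (ract (gen p) b) c) (npsi (gen p) (nleft b c))"
    using npsi_tens[of x "y * b" c] by (simp add: p npsi_gen nleft_mult)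
qed

lemma nPhi_forms_rel:
  assumes "z \<in> forms_rel"
  shows "nPhi z \<in> nrel"
proof (rule forms_rel_into[OF flin_nPhi subspace_nrel _ _ _ _ _ _ assms])
  fix a b r x y and ms us vs :: "('a, 'k) tensor2 list"
  note lin = flin_add[OF flin_npsi_left] flin_scale[OF flin_npsi_left]
    flin_add[OF flin_foldr_npsi] flin_scale[OF flin_foldr_npsi]
    flin_add[OF flin_nleft] flin_scale[OF flin_nleft]
  show "nPhi (gen (a + b, ms)) - nPhi (gen (a, ms)) - nPhi (gen (b, ms)) \<in> nrel"
    using nleft_add by (simp add: nPhi_gen ncong_def diff_diff_eq)
  show "nPhi (gen (r *s a, ms)) - fscale r (nPhi (gen (a, ms))) \<in> nrel"
    using nleft_scale by (simp add: nPhi_gen ncong_def)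
  show "nPhi (gen (a, us @ (x + y) # vs)) - nPhi (gen (a, us @ x # vs))
      - nPhi (gen (a, us @ y # vs)) \<in> nrel"
    by (simp add: nPhi_gen lin free.subspace_0[OF subspace_nrel])
  show "nPhi (gen (a, us @ fscale r x # vs)) - fscale r (nPhi (gen (a, us @ x # vs))) \<in> nrel"
    by (simp add: nPhi_gen lin free.subspace_0[OF subspace_nrel])
  show "nPhi (gen (a * b, x # vs)) - nPhi (gen (a, lact b x # vs)) \<in> nrel"
    using ncong_nleft[OF ncong_sym[OF npsi_lact]] by (simp add: nPhi_gen ncong_def nleft_mult)
  have "ncong (npsi (ract x b) (npsi y c)) (npsi x (npsi (lact b y) c))" for c
    using ncong_trans[OF npsi_ract ncong_npsi[OF ncong_sym[OF npsi_lact]]] .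
  from ncong_nleft[OF ncong_foldr_npsi[OF this]]
  show "nPhi (gen (a, us @ ract x b # y # vs)) - nPhi (gen (a, us @ x # lact b y # vs)) \<in> nrel"
    by (simp add: nPhi_gen ncong_def)
qed

text \<open>Multiplying \<open>(1, as)\<close> by dy = 1 \<otimes> y - y \<otimes> 1 gives
  \<open>(1, y # as)\<close> minus \<open>(y, 1 # as)\<close>, and the second symbol has the entry 1
  in a later place.\<close>

lemma nPhi_nform: "ncong (nPhi (nform a as)) (gen (a, as))"
proof -
  have "ncong (foldr npsi (map d1 as) (gen (1, []))) (gen (1, as))"
  proof (induction as)
    case (Cons y as)
    have "ncong (npsi (d1 y) (gen (1, as)))
        (nleft 1 (nd (nleft y (gen (1, as)))) - nleft y (nd (nleft 1 (gen (1, as)))))"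
      unfolding d1_def flin_diff[OF flin_npsi_left] by (intro ncong_diff npsi_tens)
    also have "\<dots> = gen (1, y # as) - gen (y, 1 # as)" by simp
    also have "ncong \<dots> (gen (1, y # as) - 0)"
      using nrel_one_mid[of y "[]" as] by (intro ncong_diff) (simp_all add: ncong_zero)
    finally show ?case using ncong_trans[OF ncong_npsi[OF Cons]] by simp
  qed simp
  from ncong_nleft[OF this, of a]
  have "ncong (nPhi (gen (a, map d1 as))) (gen (a, as))" by (simp add: nPhi_gen)
  moreover have "ncong (nPhi (nform a as)) (nPhi (gen (a, map d1 as)))"
    unfolding ncong_def nform_pure pure_def
    by (rule flin_quot_diff[OF subspace_forms_rel flin_nPhi nPhi_forms_rel])
  ultimately show ?thesis using ncong_trans by blast
qed

text \<open>\<open>nPhi\<close> recovers the symbol \<open>(a, as)\<close> only modulo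
  \<open>nrel\<close>, which the extension of a multilinear \<open>f\<close> kills. The existence of
  all four operators rests on this.\<close>

lemma flin_on_nforms:
  fixes f :: "'a \<Rightarrow> 'a list \<Rightarrow> ('x \<Rightarrow>\<^sub>0 'k)"
  assumes "nmultilin f"
  obtains g where "flin g" "\<And>a as. g (nform a as) = f a as"
proof
  let ?F = "lin_ext fscale (\<lambda>(a, as). f a as)"
  show "flin (\<lambda>\<omega>. ?F (nPhi \<omega>))" by (rule flin_comp[OF flin_lin_ext flin_nPhi])
  show "?F (nPhi (nform a as)) = f a as" for a as
    using nmultilin_nrel[OF assms nPhi_nform[unfolded ncong_def, of a as]]
    by (simp add: flin_diff[OF flin_lin_ext])
qed

section \<open>The operators on forms\<close>

subsection \<open>The differential\<close>

lemma nform_zero_one: "nform a (us @ 1 # vs) = 0"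
  using nmultilin_nform by (simp add: nmultilin_def)

lemma nmultilin_d: "nmultilin (\<lambda>a as. dprod (a # as))"
proof -
  note n = nmultilin_nform[unfolded nmultilin_def]
  have "nform c ((a + b) # as) = nform c (a # as) + nform c (b # as)"
    "nform c ((r *s a) # as) = fscale r (nform c (a # as))" for a b c r as
    using n[THEN conjunct2, THEN conjunct2, THEN conjunct1, rule_format, of c "[]" a b as]
      n[THEN conjunct2, THEN conjunct2, THEN conjunct2, THEN conjunct1, rule_format, of c "[]" r a as]
    by simp_all
  moreover have "nform c (a # us @ (x + y) # vs) = nform c (a # us @ x # vs) + nform c (a # us @ y # vs)"
    "nform c (a # us @ (r *s x) # vs) = fscale r (nform c (a # us @ x # vs))"
    "nform c (a # us @ 1 # vs) = 0" for a c r x y us vs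
    using n[THEN conjunct2, THEN conjunct2, THEN conjunct1, rule_format, of c "a # us" x y vs]
      n[THEN conjunct2, THEN conjunct2, THEN conjunct2, THEN conjunct1, rule_format,
        of c "a # us" r x vs]
      nform_zero_one[of c "a # us" vs]
    by simp_all
  ultimately show ?thesis unfolding nform_one[symmetric] nmultilin_def by simp
qed

text \<open>The value da_0 da_1 ... da_n on a_0 da_1 ... da_n is forced. The Leibniz rule is
  verified for the left factors dx, da_1 ... da_n and a, from which every form is obtained by
  products and sums.\<close>

lemma d_exists:
  "\<exists>g. flin g \<and> (\<forall>a. g (emb a) = dd a) \<and>
     (\<forall>n. \<forall>\<alpha>\<in>Omega_deg n. \<forall>\<beta>\<in>Omega. g (\<alpha> \<odot> \<beta>) = g \<alpha> \<odot> \<beta> + fscale ((-1) ^ n) (\<alpha> \<odot> g \<beta>)) \<and>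
     (\<forall>\<alpha>\<in>Omega. g (g \<alpha>) = 0)"
proof -
  obtain g where g: "flin g" "\<And>a as. g (nform a as) = dprod (a # as)"
    using flin_on_nforms[OF nmultilin_d] by blast
  have g_dprod: "g (dprod as) = 0" for as
    using g(2)[of 1 as] nform_zero_one[of 1 "[]" as] by (simp add: nform_one)
  have g_Omega: "g \<beta> \<in> Omega" if "\<beta> \<in> Omega" for \<beta>
    by (rule span_into[OF g(1) subspace_Omega that[unfolded Omega_def]])
      (auto intro: Omega_deg_nform_into[OF _ g(1) subspace_Omega] simp: g(2))
  have g_dd: "g (dd x \<odot> \<beta>) = - (dd x \<odot> g \<beta>)" if "\<beta> \<in> Omega" for x \<beta>
    by (rule Omega_nform_eq[OF that flin_comp[OF g(1) flin_wmult_right]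
          flin_uminus[OF flin_comp[OF flin_wmult_right g(1)]]])
      (simp add: dd_nform flin_diff[OF g(1)] g_dprod g(2), simp add: dprod_Cons)
  have g_dprod_mult: "g (dprod as \<odot> \<beta>) = fscale ((-1) ^ length as) (dprod as \<odot> g \<beta>)"
    if "\<beta> \<in> Omega" for as \<beta>
  proof (induction as)
    case Nil
    then show ?case using that by (simp add: emb_one_left g_Omega)
  next
    case (Cons a as)
    then show ?case using that
      by (simp add: dprod_Cons wmult_assoc g_dd wmult_Omega g_Omega wmult_scale_right)
  qed
  have g_emb: "g (emb a \<odot> \<beta>) = dd a \<odot> \<beta> + emb a \<odot> g \<beta>" if "\<beta> \<in> Omega" for a \<beta>
  proof (rule Omega_nform_eq[OF that flin_comp[OF g(1) flin_wmult_right]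
        flin_plus[OF flin_wmult_right flin_comp[OF flin_wmult_right g(1)]]])
    fix b bs
    show "g (emb a \<odot> nform b bs) = dd a \<odot> nform b bs + emb a \<odot> g (nform b bs)"
      by (simp add: emb_nform g(2) dprod_Cons dd_mult wmult_add_left)
        (simp add: nform_def wmult_assoc wmult_Omega)
  qed
  have "g (\<alpha> \<odot> \<beta>) = g \<alpha> \<odot> \<beta> + fscale ((-1) ^ n) (\<alpha> \<odot> g \<beta>)"
    if "\<alpha> \<in> Omega_deg n" "\<beta> \<in> Omega" for n \<alpha> \<beta>
  proof (rule Omega_deg_nform_eq[OF that(1) flin_comp[OF g(1) flin_wmult_left]
        flin_plus[OF flin_comp[OF flin_wmult_left g(1)] flin_fscale[OF flin_wmult_left]]])
    fix a and as :: "'a list" assume "length as = n"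
    then show "g (nform a as \<odot> \<beta>) = g (nform a as) \<odot> \<beta> + fscale ((-1) ^ n) (nform a as \<odot> g \<beta>)"
      using that(2) unfolding g(2) dprod_Cons
      by (simp add: nform_def wmult_assoc g_emb wmult_Omega g_dprod_mult wmult_scale_right g_Omega)
  qed
  moreover have "g (g \<alpha>) = 0" if "\<alpha> \<in> Omega" for \<alpha>
    by (rule Omega_nform_eq[OF that flin_comp[OF g(1) g(1)], of "\<lambda>_. 0"])
      (simp_all add: flin_iff g(2) g_dprod)
  moreover have "g (emb a) = dd a" for a using g(2)[of a "[]"] by simp
  ultimately show ?thesis using g(1) by blast
qed

lemmas d_spec = someI_ex[OF d_exists, folded d_op_def]

lemma flin_d: "flin d_op"
  and d_emb: "d_op (emb a) = dd a"
  and d_wmult: "\<alpha> \<in> Omega_deg n \<Longrightarrow> \<beta> \<in> Omega \<Longrightarrow>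
    d_op (\<alpha> \<odot> \<beta>) = d_op \<alpha> \<odot> \<beta> + fscale ((-1) ^ n) (\<alpha> \<odot> d_op \<beta>)"
  and d_d: "\<alpha> \<in> Omega \<Longrightarrow> d_op (d_op \<alpha>) = 0"
  using d_spec by blast+

lemma d_dd: "d_op (dd a) = 0"
  using d_d[of "emb a"] by (simp add: d_emb)

lemma d_dprod: "d_op (dprod as) = 0"
proof (induction as)
  case Nil
  then show ?case by (simp add: d_emb dd_one)
next
  case (Cons a as)
  then show ?case
    by (simp add: dprod_Cons d_wmult[OF dd_deg] d_dd wmult_zero_left wmult_zero_right)
qed

lemma d_nform: "d_op (nform a as) = dprod (a # as)"
  by (simp add: nform_def d_wmult[OF emb_deg] d_emb d_dprod wmult_zero_right dprod_Cons)

lemma d_deg: "\<alpha> \<in> Omega_deg n \<Longrightarrow> d_op \<alpha> \<in> Omega_deg (Suc n)"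
  by (erule Omega_deg_nform_into[OF _ flin_d subspace_Omega_deg]) (simp add: d_nform dprod_deg)

subsection \<open>The Hochschild differential\<close>

lemma flin_comm_left: "flin (\<lambda>\<alpha>. comm \<alpha> \<beta>)"
  unfolding comm_def by (rule flin_minus[OF flin_wmult_left flin_wmult_right])

lemma flin_comm_right: "flin (\<lambda>\<beta>. comm \<alpha> \<beta>)"
  unfolding comm_def by (rule flin_minus[OF flin_wmult_right flin_wmult_left])

lemma comm_one: "\<alpha> \<in> Omega \<Longrightarrow> comm \<alpha> (emb 1) = 0"
  by (simp add: comm_def emb_one_left emb_one_right)

text \<open>The rule reads off the last entry and so prescribes the value on a_0 da_1 ... da_n for n
  > 0. An entry 1 gives 0: in the last place as a commutator with 1, elsewhere because the form
  inside the commutator vanishes.\<close>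

lemma b_exists:
  "\<exists>g. flin g \<and> (\<forall>a. g (emb a) = 0) \<and>
     (\<forall>n a. \<forall>\<alpha>\<in>Omega_deg n. g (\<alpha> \<odot> dd a) = fscale ((-1) ^ n) (comm \<alpha> (emb a)))"
proof -
  let ?f = "\<lambda>a as. if as = [] then 0
    else fscale ((-1) ^ (length as - 1)) (comm (nform a (butlast as)) (emb (last as)))"
  note n = nmultilin_nform[unfolded nmultilin_def]
  have "nmultilin ?f"
    unfolding nmultilin_def
  proof (intro conjI allI)
    fix a b r x y and as us vs :: "'a list"
    show "?f (a + b) as = ?f a as + ?f b as" "?f (r *s a) as = fscale r (?f a as)"
      using n by (simp_all add: flin_add[OF flin_comm_left] flin_scale[OF flin_comm_left]
          free.scale_right_distrib mult.commute)
    show "?f a (us @ (x + y) # vs) = ?f a (us @ x # vs) + ?f a (us @ y # vs)"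
      using n by (cases vs rule: rev_cases)
        (simp_all add: flin_add[OF flin_comm_left] flin_add[OF flin_comm_right] emb_add
          free.scale_right_distrib butlast_append)
    show "?f a (us @ (r *s x) # vs) = fscale r (?f a (us @ x # vs))"
      using n by (cases vs rule: rev_cases)
        (simp_all add: flin_scale[OF flin_comm_left] flin_scale[OF flin_comm_right] emb_scale
          mult.commute butlast_append)
    show "?f a (us @ 1 # vs) = 0"
      using n by (cases vs rule: rev_cases)
        (simp_all add: flin_zero[OF flin_comm_left] comm_one butlast_append)
  qed
  then obtain g where g: "flin g" "\<And>a as. g (nform a as) = ?f a as"
    using flin_on_nforms by blast
  have "g (\<alpha> \<odot> dd a) = fscale ((-1) ^ n) (comm \<alpha> (emb a))" if "\<alpha> \<in> Omega_deg n" for n a \<alpha>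
    by (rule Omega_deg_nform_eq[OF that flin_comp[OF g(1) flin_wmult_left]
          flin_fscale[OF flin_comm_left]])
      (simp add: nform_snoc g(2))
  moreover have "g (emb a) = 0" for a using g(2)[of a "[]"] by simp
  ultimately show ?thesis using g(1) by blast
qed

lemmas b_spec = someI_ex[OF b_exists, folded b_op_def]

lemma flin_b: "flin b_op"
  and b_emb: "b_op (emb a) = 0"
  and b_dd: "\<alpha> \<in> Omega_deg n \<Longrightarrow> b_op (\<alpha> \<odot> dd a) = fscale ((-1) ^ n) (comm \<alpha> (emb a))"
  using b_spec by blast+

lemma b_deg_zero: "\<alpha> \<in> Omega_deg 0 \<Longrightarrow> b_op \<alpha> = 0"
  by (erule Omega_deg_nform_eq[OF _ flin_b, of _ _ "\<lambda>_. 0"]) (simp_all add: flin_iff b_emb)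

lemma comm_deg: "\<alpha> \<in> Omega_deg n \<Longrightarrow> comm \<alpha> (emb a) \<in> Omega_deg n"
  using wmult_deg[of \<alpha> n "emb a" 0] wmult_deg[of "emb a" 0 \<alpha> n]
  by (simp add: comm_def free.subspace_diff[OF subspace_Omega_deg])

lemma b_deg: "\<alpha> \<in> Omega_deg (Suc n) \<Longrightarrow> b_op \<alpha> \<in> Omega_deg n"
proof (erule Omega_deg_nform_into[OF _ flin_b subspace_Omega_deg])
  fix a and as :: "'a list" assume "length as = Suc n"
  then obtain bs x where "as = bs @ [x]" "length bs = n"
    by (metis length_Suc_conv_rev)
  then show "b_op (nform a as) \<in> Omega_deg n"
    by (simp add: nform_snoc[symmetric] b_dd[OF nform_deg] comm_deg[OF nform_deg]
        free.subspace_scale[OF subspace_Omega_deg])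
qed

text \<open>For \<omega> dx dy the outer b meets [\<omega> dx, y], where dx y = d(xy) - x dy; up to
  sign the result is [\<omega>, xy] - [\<omega> x, y] - [y \<omega>, x] = 0. Forms of degree 0 and 1
  vanish for reasons of degree.\<close>

lemma b_b:
  assumes "\<alpha> \<in> Omega"
  shows "b_op (b_op \<alpha>) = 0"
proof (rule Omega_nform_eq[OF assms flin_comp[OF flin_b flin_b], of "\<lambda>_. 0"])
  show "flin (\<lambda>_. 0)" by (simp add: flin_iff)
  fix a and as :: "'a list"
  show "b_op (b_op (nform a as)) = 0"
  proof (cases as rule: rev_cases)
    case Nil
    then show ?thesis by (simp add: b_emb flin_zero[OF flin_b])
  next
    case (snoc bs y)
    show ?thesis
    proof (cases bs rule: rev_cases)
      case Nil
      then show ?thesis using snoc by (intro b_deg_zero b_deg nform_deg) simp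
    next
      case (snoc cs x)
      define n \<omega> where "n = length cs" and "\<omega> = nform a cs"
      have \<omega>: "\<omega> \<in> Omega_deg n" "\<omega> \<in> Omega" by (simp_all add: n_def \<omega>_def nform_deg)
      have deg: "\<omega> \<odot> dd x \<in> Omega_deg (Suc n)" "\<omega> \<odot> emb x \<in> Omega_deg n"
        "emb y \<odot> \<omega> \<in> Omega_deg n"
        using wmult_deg[OF \<omega>(1) dd_deg] wmult_deg[OF \<omega>(1) emb_deg] wmult_deg[OF emb_deg \<omega>(1)]
        by simp_all
      have "dd x \<odot> emb y = dd (x * y) - emb x \<odot> dd y" by (simp add: dd_mult)
      then have "comm (\<omega> \<odot> dd x) (emb y)
          = \<omega> \<odot> dd (x * y) - (\<omega> \<odot> emb x) \<odot> dd y - (emb y \<odot> \<omega>) \<odot> dd x"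
        by (simp add: comm_def wmult_assoc \<omega> wmult_diff_right)
      then have "b_op (comm (\<omega> \<odot> dd x) (emb y)) = 0"
        by (simp add: flin_diff[OF flin_b] b_dd[OF \<omega>(1)] b_dd[OF deg(2)] b_dd[OF deg(3)]
            free.scale_right_diff_distrib[symmetric])
          (simp add: comm_def wmult_assoc \<omega> wmult_Omega emb_mult)
      moreover have "nform a as = (\<omega> \<odot> dd x) \<odot> dd y"
        by (simp add: \<open>as = bs @ [y]\<close> snoc \<omega>_def nform_snoc)
      ultimately show ?thesis
        by (simp add: b_dd[OF deg(1)] flin_scale[OF flin_b] del: power_Suc)
    qed
  qed
qed

subsection \<open>The Karoubi operator\<close>

abbreviation karoubi :: "('a, 'k) form \<Rightarrow> ('a, 'k) form" where
  "karoubi \<equiv> kop b_op d_op"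

lemma flin_karoubi: "flin karoubi"
  unfolding kop_def
  by (intro flin_minus flin_id flin_comp[OF flin_b flin_d] flin_comp[OF flin_d flin_b])

lemmas flin_karoubi_pow = flin_funpow[OF flin_karoubi]

text \<open>Here bd contributes -(-1)^n [d\<alpha>, a] and db contributes (-1)^n d[\<alpha>, a]. The
  commutators with d\<alpha> cancel, and \<alpha> da - (-1)^n da \<alpha> remains to be
  subtracted.\<close>

lemma karoubi_dd:
  assumes "\<alpha> \<in> Omega_deg n"
  shows "karoubi (\<alpha> \<odot> dd a) = fscale ((-1) ^ n) (dd a \<odot> \<alpha>)"
proof -
  have \<alpha>: "\<alpha> \<in> Omega" by (rule Omega_deg_Omega[OF assms])
  have "d_op (\<alpha> \<odot> dd a) = d_op \<alpha> \<odot> dd a"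
    by (simp add: d_wmult[OF assms] d_dd wmult_zero_right)
  then have "b_op (d_op (\<alpha> \<odot> dd a)) = - fscale ((-1) ^ n) (comm (d_op \<alpha>) (emb a))"
    by (simp add: b_dd[OF d_deg[OF assms]])
  moreover have "d_op (\<alpha> \<odot> emb a) = d_op \<alpha> \<odot> emb a + fscale ((-1) ^ n) (\<alpha> \<odot> dd a)"
    "d_op (emb a \<odot> \<alpha>) = dd a \<odot> \<alpha> + emb a \<odot> d_op \<alpha>"
    by (simp_all add: d_wmult[OF assms] d_wmult[OF emb_deg \<alpha>] d_emb)
  ultimately show ?thesis
    by (cases "even n") (simp_all add: kop_def b_dd[OF assms] flin_diff[OF flin_d] comm_def)
qed

text \<open>Each application moves the last letter to the front with sign (-1)^(l-1), where l is the
  number of letters and stays the same throughout.\<close>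

lemma karoubi_pow_nform:
  "(karoubi ^^ length cs) (nform a (bs @ cs)) =
    fscale ((-1) ^ (length cs * (length bs + length cs - 1))) (dprod cs \<odot> emb a \<odot> dprod bs)"
proof (induction cs arbitrary: bs)
  case Nil
  then show ?case by (simp add: nform_def emb_one_left)
next
  case (Cons c cs)
  let ?N = "length bs + length cs"
  define \<alpha> where "\<alpha> = dprod cs \<odot> emb a \<odot> dprod bs"
  have \<alpha>: "\<alpha> \<in> Omega_deg ?N"
    unfolding \<alpha>_def
    using wmult_deg[OF wmult_deg[OF dprod_deg[OF refl, of cs] emb_deg[of a]]
        dprod_deg[OF refl, of bs]]
    by (simp add: add.commute)
  have "(karoubi ^^ length (c # cs)) (nform a (bs @ c # cs))
      = karoubi ((karoubi ^^ length cs) (nform a ((bs @ [c]) @ cs)))" by simp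
  also have "\<dots> = karoubi (fscale ((-1) ^ (length cs * ?N)) (\<alpha> \<odot> dd c))"
    unfolding Cons by (simp add: \<alpha>_def dprod_append wmult_assoc wmult_Omega)
  also have "\<dots> = fscale ((-1) ^ (length (c # cs) * ?N)) (dd c \<odot> \<alpha>)"
    by (simp add: flin_scale[OF flin_karoubi] karoubi_dd[OF \<alpha>] power_add mult.commute)
  finally show ?case by (simp add: \<alpha>_def dprod_Cons wmult_assoc wmult_Omega)
qed

text \<open>By n rotations a_0 da_1 ... da_n becomes da_1 ... da_n a_0. The difference is the
  commutator [da_1 ... da_n, a_0], which is b of (-1)^n da_1 ... da_n da_0, and the latter arises
  from da_0 da_1 ... da_n by n rotations.\<close>

lemma karoubi_pow_deg:
  assumes "\<alpha> \<in> Omega_deg n"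
  shows "(karoubi ^^ n) \<alpha> = \<alpha> + b_op ((karoubi ^^ n) (d_op \<alpha>))"
proof (rule Omega_deg_nform_eq[OF assms flin_karoubi_pow
      flin_plus[OF flin_id flin_comp[OF flin_b flin_comp[OF flin_karoubi_pow flin_d]]]])
  fix a and as :: "'a list" assume n: "length as = n"
  have "even (n * (n - 1))" by (cases n) auto
  then have "(karoubi ^^ n) (nform a as) = dprod as \<odot> emb a"
    using karoubi_pow_nform[of as a "[]"] n by (simp add: emb_one_right wmult_Omega)
  moreover have "(karoubi ^^ n) (d_op (nform a as)) = fscale ((-1) ^ n) (dprod as \<odot> dd a)"
    using karoubi_pow_nform[of as 1 "[a]"] n
    by (simp add: d_nform nform_one emb_one_right minus_one_power_iff)
  moreover have "b_op (fscale ((-1) ^ n) (dprod as \<odot> dd a)) = comm (dprod as) (emb a)"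
    by (simp add: flin_scale[OF flin_b] b_dd[OF dprod_deg[OF n]] power_add[symmetric]
        flip: power_mult_distrib)
  ultimately show "(karoubi ^^ n) (nform a as)
      = nform a as + b_op ((karoubi ^^ n) (d_op (nform a as)))"
    by (simp add: comm_def nform_def)
qed

subsection \<open>The Connes differential and the contraction\<close>

text \<open>The i-th cyclic term is reached by j = n+1-i rotations. Rotating n+1 letters j times
  carries the sign (-1)^(jn), and jn has the parity of ni because their sum n(n+1) is even.\<close>

lemma B_formula:
  assumes "length as = n + 1"
  shows "(\<Sum>i=0..n. fscale ((-1) ^ (n * i)) (dprod (drop i as @ take i as)))
    = (\<Sum>j<Suc n. (karoubi ^^ j) (dprod as))"
proof -
  have K: "(karoubi ^^ j) (dprod as)
      = fscale ((-1) ^ (n * (Suc n - j))) (dprod (drop (Suc n - j) as @ take (Suc n - j) as))"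
    if "j \<le> Suc n" for j
  proof -
    let ?i = "Suc n - j"
    have len: "length (drop ?i as) = j" "length (take ?i as) + j - 1 = n" using assms that by auto
    have "j * n + n * ?i = n * Suc n" using that
      by (metis add_mult_distrib2 le_add_diff_inverse mult.commute)
    then have "even (j * n) \<longleftrightarrow> even (n * ?i)"
      by (metis even_Suc even_add even_mult_iff)
    then have "((-1) ^ (j * n) :: 'k) = (-1) ^ (n * ?i)" by (simp add: minus_one_power_iff)
    then show ?thesis
      using karoubi_pow_nform[of "drop ?i as" 1 "take ?i as"] len
      by (simp add: nform_one dprod_append emb_one_right)
  qed
  \<comment> \<open>The reversal of i to n+1-i would send 0 to n+1, so the unrotated terms i = 0 and
    j = 0 are matched separately.\<close>
  have "(\<Sum>i=1..n. fscale ((-1) ^ (n * i)) (dprod (drop i as @ take i as)))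
      = (\<Sum>j=1..n. (karoubi ^^ j) (dprod as))"
    by (rule sum.reindex_bij_witness[of _ "\<lambda>j. Suc n - j" "\<lambda>i. Suc n - i"]) (auto simp: K)
  moreover have "{0..n} = insert 0 {1..n}" "{..<Suc n} = insert 0 {1..n}" by auto
  ultimately show ?thesis by simp
qed

text \<open>Once the cyclic sum is a linear expression in \<open>nform a as\<close>, its
  multilinearity in the entries is inherited instead of being checked on words.\<close>

lemma B_exists:
  "\<exists>g. flin g \<and> (\<forall>n as. length as = n + 1 \<longrightarrow>
        g (nform (as ! 0) (tl as)) =
          (\<Sum>i=0..n. fscale ((-1) ^ (n * i)) (dprod (drop i as @ take i as))))"
proof -
  have "nmultilin (\<lambda>a as. (\<lambda>n \<alpha>. \<Sum>j<Suc n. (karoubi ^^ j) (d_op \<alpha>)) (length as) (nform a as))"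
    by (rule nmultilin_flin[OF nmultilin_nform, of "\<lambda>n \<alpha>. \<Sum>j<Suc n. (karoubi ^^ j) (d_op \<alpha>)"])
      (rule flin_setsum, rule flin_comp[OF flin_karoubi_pow flin_d])
  then obtain g where g: "flin g"
    "\<And>a as. g (nform a as) = (\<Sum>j<Suc (length as). (karoubi ^^ j) (d_op (nform a as)))"
    using flin_on_nforms by blast
  have "g (nform (as ! 0) (tl as)) =
      (\<Sum>i=0..n. fscale ((-1) ^ (n * i)) (dprod (drop i as @ take i as)))"
    if "length as = n + 1" for n as
    unfolding B_formula[OF that] using that by (cases as) (simp_all add: g(2) d_nform del: sum.lessThan_Suc)
  then show ?thesis using g(1) by blast
qed

lemmas B_spec = someI_ex[OF B_exists, folded B_op_def]

lemma flin_B: "flin B_op"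
  using B_spec by blast

lemma B_deg_eq:
  assumes "\<alpha> \<in> Omega_deg n"
  shows "B_op \<alpha> = (\<Sum>j<Suc n. (karoubi ^^ j) (d_op \<alpha>))"
proof (rule Omega_deg_nform_eq[OF assms flin_B flin_setsum[OF flin_comp[OF flin_karoubi_pow flin_d]]])
  fix a and as :: "'a list" assume "length as = n"
  then show "B_op (nform a as) = (\<Sum>j<Suc n. (karoubi ^^ j) (d_op (nform a as)))"
    using B_spec[THEN conjunct2, rule_format, of "a # as" n] B_formula[of "a # as" n]
    by (simp add: d_nform del: sum.lessThan_Suc)
qed

text \<open>After n-k rotations da_k is the last letter, so b produces the commutator of the
  remaining factors with a_k; interchanging its entries gives the minus sign. The exponents
  (n-k+1)(n-1) and (k-1)(n-1) add up to n(n-1), which is even.\<close>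

lemma iota_formula:
  assumes "length as = n + 1" "n \<ge> 1"
  shows "(\<Sum>k=1..n. fscale ((-1) ^ ((k - 1) * (n - 1)))
             (comm (emb (as ! k))
                   (dprod (drop (k + 1) as) \<odot> emb (as ! 0) \<odot> dprod (take (k - 1) (tl as)))))
    = - b_op (\<Sum>j<n. (karoubi ^^ j) (nform (as ! 0) (tl as)))"
proof -
  obtain a xs where as: "as = a # xs" "length xs = n" using assms(1) by (cases as) auto
  have summand: "fscale ((-1) ^ (i * (n - 1)))
      (comm (emb (xs ! i)) (dprod (drop (Suc i) xs) \<odot> emb a \<odot> dprod (take i xs)))
    = - b_op ((karoubi ^^ (n - Suc i)) (nform a xs))" if i: "i < n" for i
  proof -
    define \<alpha> where "\<alpha> = dprod (drop (Suc i) xs) \<odot> emb a \<odot> dprod (take i xs)"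
    have \<alpha>: "\<alpha> \<in> Omega_deg (n - 1)"
      using wmult_deg[OF wmult_deg[OF dprod_deg[OF refl, of "drop (Suc i) xs"] emb_deg[of a]]
          dprod_deg[OF refl, of "take i xs"]] as(2) i
      by (simp add: \<alpha>_def)
    have "(karoubi ^^ (n - Suc i)) (nform a xs) = fscale ((-1) ^ ((n - Suc i) * (n - 1)))
        (dprod (drop (Suc i) xs) \<odot> emb a \<odot> dprod (take (Suc i) xs))"
      using karoubi_pow_nform[of "drop (Suc i) xs" a "take (Suc i) xs"] as(2) i by simp
    also have "dprod (drop (Suc i) xs) \<odot> emb a \<odot> dprod (take (Suc i) xs) = \<alpha> \<odot> dd (xs ! i)"
      using as(2) i
      by (simp add: take_Suc_conv_app_nth dprod_append \<alpha>_def wmult_assoc wmult_Omega)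
    finally have "b_op ((karoubi ^^ (n - Suc i)) (nform a xs))
        = fscale ((-1) ^ ((n - Suc i) * (n - 1)) * (-1) ^ (n - 1)) (comm \<alpha> (emb (xs ! i)))"
      by (simp add: flin_scale[OF flin_b] b_dd[OF \<alpha>])
    moreover have "((-1) ^ ((n - Suc i) * (n - 1)) * (-1) ^ (n - 1) :: 'k) = (-1) ^ (i * (n - 1))"
    proof -
      obtain m where "n = m + Suc i" using i by (metis add.commute less_iff_Suc_add add_Suc_right)
      then show ?thesis
        by (cases "even m"; cases "even i") (simp_all add: minus_one_power_iff)
    qed
    moreover have "comm (emb (xs ! i)) \<alpha> = - comm \<alpha> (emb (xs ! i))" by (simp add: comm_def)
    ultimately show ?thesis by (simp add: \<alpha>_def)
  qed
  have "(\<Sum>k=1..n. fscale ((-1) ^ ((k - 1) * (n - 1)))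
             (comm (emb (as ! k))
                   (dprod (drop (k + 1) as) \<odot> emb (as ! 0) \<odot> dprod (take (k - 1) (tl as)))))
    = (\<Sum>i<n. fscale ((-1) ^ (i * (n - 1)))
      (comm (emb (xs ! i)) (dprod (drop (Suc i) xs) \<odot> emb a \<odot> dprod (take i xs))))"
    by (rule sum.reindex_bij_witness[of _ Suc "\<lambda>k. k - 1"]) (auto simp: as(1))
  also have "\<dots> = (\<Sum>i<n. - b_op ((karoubi ^^ (n - Suc i)) (nform a xs)))"
    by (rule sum.cong[OF refl]) (rule summand, simp)
  also have "\<dots> = (\<Sum>j<n. - b_op ((karoubi ^^ j) (nform a xs)))"
    by (rule sum.nat_diff_reindex)
  finally show ?thesis by (simp add: as(1) flin_sum[OF flin_b] sum_negf)
qed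

lemma iota_exists:
  "\<exists>g. flin g \<and> (\<forall>a. g (emb a) = 0) \<and>
     (\<forall>n as. n \<ge> 1 \<longrightarrow> length as = n + 1 \<longrightarrow>
        g (nform (as ! 0) (tl as)) =
          (\<Sum>k=1..n. fscale ((-1) ^ ((k - 1) * (n - 1)))
             (comm (emb (as ! k))
                   (dprod (drop (k + 1) as) \<odot> emb (as ! 0) \<odot> dprod (take (k - 1) (tl as))))))"
proof -
  have "nmultilin (\<lambda>a as. (\<lambda>n \<alpha>. - b_op (\<Sum>j<n. (karoubi ^^ j) \<alpha>)) (length as) (nform a as))"
    by (rule nmultilin_flin[OF nmultilin_nform, of "\<lambda>n \<alpha>. - b_op (\<Sum>j<n. (karoubi ^^ j) \<alpha>)"])
      (rule flin_uminus, rule flin_comp[OF flin_b flin_setsum], rule flin_karoubi_pow)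
  then obtain g where g: "flin g"
    "\<And>a as. g (nform a as) = - b_op (\<Sum>j<length as. (karoubi ^^ j) (nform a as))"
    using flin_on_nforms by blast
  have "g (emb a) = 0" for a using g(2)[of a "[]"] by (simp add: flin_zero[OF flin_b])
  moreover have "g (nform (as ! 0) (tl as)) =
          (\<Sum>k=1..n. fscale ((-1) ^ ((k - 1) * (n - 1)))
             (comm (emb (as ! k))
                   (dprod (drop (k + 1) as) \<odot> emb (as ! 0) \<odot> dprod (take (k - 1) (tl as)))))"
    if "n \<ge> 1" "length as = n + 1" for n as
    unfolding iota_formula[OF that(2,1)] using that by (simp add: g(2))
  ultimately show ?thesis using g(1) by blast
qed

lemmas iota_spec = someI_ex[OF iota_exists, folded iota_op_def]

lemma flin_iota: "flin iota_op"
  and iota_emb: "iota_op (emb a) = 0"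
  using iota_spec by blast+

lemma iota_deg_eq:
  assumes "\<alpha> \<in> Omega_deg n"
  shows "iota_op \<alpha> = - b_op (\<Sum>j<n. (karoubi ^^ j) \<alpha>)"
proof (rule Omega_deg_nform_eq[OF assms flin_iota])
  show "flin (\<lambda>\<alpha>. - b_op (\<Sum>j<n. (karoubi ^^ j) \<alpha>))"
    by (rule flin_uminus, rule flin_comp[OF flin_b flin_setsum], rule flin_karoubi_pow)
  fix a and as :: "'a list" assume n: "length as = n"
  show "iota_op (nform a as) = - b_op (\<Sum>j<n. (karoubi ^^ j) (nform a as))"
  proof (cases "n = 0")
    case True
    then show ?thesis using n by (simp add: iota_emb flin_zero[OF flin_b])
  next
    case False
    then show ?thesis
      using iota_spec[THEN conjunct2, THEN conjunct2, rule_format, of n "a # as"]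
        iota_formula[of "a # as" n] n by simp
  qed
qed

end

section \<open>Reduced forms\<close>

context unital_algebra
begin

lemma flin_red: "flin red"
  unfolding red_def by (rule flin_quot) simp

lemma flin_red_op: "flin f \<Longrightarrow> flin (red_op f)"
  unfolding red_op_def by (rule flin_comp[OF flin_red])

text \<open>\<open>red \<alpha>\<close> differs from \<open>\<alpha>\<close> by a multiple of the
  unit, which \<open>f\<close> kills, so the induced operator may be computed on any
  representative.\<close>

lemma red_op_red:
  assumes "flin f" "f (emb 1) = 0"
  shows "red_op f (red \<alpha>) = red (f \<alpha>)"
proof -
  have "f x = 0" if "x \<in> free.span {emb 1}" for x
    using span_into[OF assms(1) free.subspace_single_0 that] assms(2) by simp
  then show ?thesis
    unfolding red_op_def red_def by (subst flin_quot_eq[OF _ assms(1)]) simp_all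
qed

lemma B_emb_one: "B_op (emb 1) = 0"
  by (simp add: B_deg_eq[OF emb_deg] d_emb dd_one)

lemmas red_op_simps = red_op_red[OF flin_d] red_op_red[OF flin_b b_emb]
  red_op_red[OF flin_B B_emb_one] red_op_red[OF flin_iota iota_emb]

lemma red_d: "red_op d_op (red \<alpha>) = red (d_op \<alpha>)"
  by (simp add: red_op_red[OF flin_d] d_emb dd_one)

lemma red_karoubi_pow:
  "(kop (red_op b_op) (red_op d_op) ^^ j) (red \<alpha>) = red ((karoubi ^^ j) \<alpha>)"
  by (induction j)
    (simp_all add: kop_def[of "red_op b_op"] kop_def[of b_op] red_op_simps red_d
      flin_diff[OF flin_red])

lemma red_Omega_cases:
  assumes "x \<in> red_Omega k" "x = 0 \<Longrightarrow> P"
    "\<And>n \<alpha>. k = int n \<Longrightarrow> \<alpha> \<in> Omega_deg n \<Longrightarrow> x = red \<alpha> \<Longrightarrow> P"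
  shows P
proof (cases "k \<ge> 0")
  case True
  then obtain \<alpha> where "\<alpha> \<in> Omega_deg (nat k)" "x = red \<alpha>"
    using assms(1) by (auto simp: red_Omega_def)
  then show P using True assms(3)[of "nat k"] by simp
qed (use assms in \<open>simp add: red_Omega_def\<close>)

lemma red_Omega_int: "x \<in> red_Omega (int n) \<longleftrightarrow> (\<exists>\<alpha>\<in>Omega_deg n. x = red \<alpha>)"
  by (auto simp: red_Omega_def)

lemma red_Omega_neg: "k < 0 \<Longrightarrow> red_Omega k = {0}"
  by (simp add: red_Omega_def)

lemma subspace_red_Omega: "free.subspace (red_Omega k)"
  by (simp add: red_Omega_def subspace_flin_image[OF flin_red subspace_Omega_deg])

lemma red_op_zero: "flin f \<Longrightarrow> red_op f 0 = 0"
  by (rule flin_zero[OF flin_red_op])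

lemma red_d_Omega: "x \<in> red_Omega k \<Longrightarrow> red_op d_op x \<in> red_Omega (k + 1)"
proof (erule red_Omega_cases)
  fix n \<alpha> assume "k = int n" "\<alpha> \<in> Omega_deg n" "x = red \<alpha>"
  then show ?thesis using red_Omega_int[of _ "Suc n"] d_deg by (auto simp: red_d add.commute)
qed (simp add: red_op_zero[OF flin_d] free.subspace_0[OF subspace_red_Omega])

lemma red_b_Omega: "x \<in> red_Omega k \<Longrightarrow> red_op b_op x \<in> red_Omega (k - 1)"
proof (erule red_Omega_cases)
  fix n \<alpha> assume *: "k = int n" "\<alpha> \<in> Omega_deg n" "x = red \<alpha>"
  show ?thesis
  proof (cases n)
    case 0
    then show ?thesis using * by (simp add: red_op_simps b_deg_zero flin_zero[OF flin_red]
        free.subspace_0[OF subspace_red_Omega])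
  next
    case (Suc m)
    then show ?thesis using * red_Omega_int[of _ m] b_deg by (auto simp: red_op_simps)
  qed
qed (simp add: red_op_zero[OF flin_b] free.subspace_0[OF subspace_red_Omega])

lemma red_d_d: "x \<in> red_Omega k \<Longrightarrow> red_op d_op (red_op d_op x) = 0"
  by (erule red_Omega_cases)
    (simp_all add: red_op_zero[OF flin_d] red_d d_d[OF Omega_deg_Omega] flin_zero[OF flin_red])

lemma red_b_b: "x \<in> red_Omega k \<Longrightarrow> red_op b_op (red_op b_op x) = 0"
  by (erule red_Omega_cases)
    (simp_all add: red_op_zero[OF flin_b] red_op_simps b_b[OF Omega_deg_Omega] flin_zero[OF flin_red])

lemma
  assumes "x \<in> red_Omega (int n)"
  defines "K \<equiv> kop (red_op b_op) (red_op d_op)"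
  shows red_karoubi_pow_deg: "(K ^^ n) x = x + red_op b_op ((K ^^ n) (red_op d_op x))"
    and red_B_eq: "red_op B_op x = (\<Sum>j<Suc n. (K ^^ j) (red_op d_op x))"
    and red_iota_eq: "red_op iota_op x = - red_op b_op (\<Sum>j<n. (K ^^ j) x)"
proof -
  obtain \<alpha> where \<alpha>: "\<alpha> \<in> Omega_deg n" and x: "x = red \<alpha>"
    using assms(1) by (auto simp: red_Omega_int)
  note red_simps = red_op_simps red_d red_karoubi_pow x K_def
  show "(K ^^ n) x = x + red_op b_op ((K ^^ n) (red_op d_op x))"
    by (simp add: red_simps karoubi_pow_deg[OF \<alpha>] flin_add[OF flin_red])
  show "red_op B_op x = (\<Sum>j<Suc n. (K ^^ j) (red_op d_op x))"
    by (simp add: red_simps B_deg_eq[OF \<alpha>] flin_sum[OF flin_red] flin_add[OF flin_red])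
  show "red_op iota_op x = - red_op b_op (\<Sum>j<n. (K ^^ j) x)"
    by (simp add: red_simps iota_deg_eq[OF \<alpha>] flin_sum[OF flin_red, symmetric] flin_neg[OF flin_red])
qed

end

theorem theorem4p3p2:
  fixes scale :: "'k::field_char_0 \<Rightarrow> 'a::{ring,monoid_mult} \<Rightarrow> 'a"
  assumes "unital_algebra scale"
  shows "\<forall>n::int. isomorphic sscale
      (unital_algebra.homology scale
         (unital_algebra.red_op scale (unital_algebra.d_op scale))
         (unital_algebra.red_op scale (unital_algebra.iota_op scale)) n)
      (unital_algebra.HP scale (- n))"
proof
  fix n :: int
  interpret unital_algebra scale by (rule assms)
  interpret karoubi_complex red_Omega "red_op d_op" "red_op b_op" "red_op B_op" "red_op iota_op"
    by (rule karoubi_complex.intro)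
      (fact subspace_red_Omega red_Omega_neg flin_red_op[OF flin_d] flin_red_op[OF flin_b]
        flin_red_op[OF flin_B] flin_red_op[OF flin_iota] red_d_Omega red_b_Omega red_d_d red_b_b
        red_karoubi_pow_deg red_B_eq red_iota_eq)+
  \<comment> \<open>\<open>HP\<close> negates its argument, so \<open>HP (- n)\<close> is the
    homology in degree n.\<close>
  show "isomorphic sscale (homology (red_op d_op) (red_op iota_op) n) (HP (- n))"
    using isomorphic_homology[of n] by (simp add: homology_def HP_def C_def chains_def)
qed

end
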